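(* Let $n,m,p$ be positive integers, let $A:\mathbb{R}^m\to\mathbb{R}^{n\times n}$, $B:\mathbb{R}^m\to\mathbb{R}^n$ be continuous, let $C\in\mathbb{R}^{p\times n}$, and let $\lambda:\mathbb{R}^n\to\mathbb{R}^m$ be continuous with $\lambda(0)=0$. For $\alpha>0$ and a positive definite matrix $P\in\mathbb{R}^{n\times n}$ consider the system on $\mathbb{R}^n\times\mathbb{R}^n$ $$(\mathrm{S}_{\alpha,P})\qquad \dot{\hat x}=A(\lambda(\hat x))\hat x+B(\lambda(\hat x))-\alpha P^{-1}C'C\varepsilon,\qquad \dot\varepsilon=\bigl(A(\lambda(\hat x))-\alpha P^{-1}C'C\bigr)\varepsilon .$$ Assume that for all $\alpha>0$, all positive definite $P\in\mathbb{R}^{n\times n}$ and all $(\hat x_0,\varepsilon_0)\in\mathbb{R}^n\times\mathbb{R}^n$, the system $(\mathrm{S}_{\alpha,P})$ has a unique solution $(\hat x,\varepsilon)$ defined on $\mathbb{R}_+=[0,+\infty)$ with $(\hat x(0),\varepsilon(0))=(\hat x_0,\varepsilon_0)$. Assume moreover: 1. (State feedback stabilizability) There is a non-empty open set $\mathcal{D}\subset\mathbb{R}^n$ such that $0$ is an asymptotically stable equilibrium point, with basin of attraction $\mathcal{D}$, of the vector field $f:x\mapsto A(\lambda(x))x+B(\lambda(x))$ on $\mathbb{R}^n$. 2. (Dissipativity) $P\in\mathbb{R}^{n\times n}$ is a (fixed) positive definite matrix such that $x'PA(\lambda(\hat x))x\leq 0$ for all $(x,\hat x)\in\mathbb{R}^n\times\mathcal{D}$.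 3. (Target detectability) The pair $(C,A(0))$ is detectable. Then for any compact set $K_1\times K_2\subset\mathcal{D}\times\mathbb{R}^n$ there exists $\alpha_0>0$ such that for all $\alpha\in(0,\alpha_0)$, $(0,0)$ is an asymptotically stable equilibrium point of $(\mathrm{S}_{\alpha,P})$ (with the matrix $P$ of item 2) whose basin of attraction contains $K_1\times K_2$.
   Context: A prime denotes matrix transpose; positive definite matrices are symmetric. The pair $(C,A_0)$ with $A_0\in\mathbb{R}^{n\times n}$ is detectable if every solution of $\dot\omega=A_0\omega$ with $C\omega\equiv0$ satisfies $\omega(t)\to0$ as $t\to+\infty$. An equilibrium is asymptotically stable if it is Lyapunov stable and attracts all solutions starting in some neighborhood of it; its basin of attraction is the set of all initial conditions whose solutions are defined for all $t\ge0$ and converge to it. *)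

theory Defs
  imports "HOL-Analysis.Analysis"
begin

text \<open>
  Forward-time solutions of \<open>x' = f x\<close> on an interval \<open>J\<close> with left endpoint \<open>0\<close>;
  the derivative at \<open>0\<close> (and at a right endpoint belonging to \<open>J\<close>) is one-sided.
  Since \<open>x\<close> is a total function, only its restriction to \<open>J\<close> is meaningful.
\<close>

definition solution_on ::
    "('a::real_normed_vector \<Rightarrow> 'a) \<Rightarrow> (real \<Rightarrow> 'a) \<Rightarrow> real set \<Rightarrow> bool" where
  "solution_on f x J \<longleftrightarrow>
     is_interval J \<and> 0 \<in> J \<and> J \<subseteq> {0..} \<and>
     (\<forall>t\<in>J. (x has_vector_derivative f (x t)) (at t within J))"

definition maximal_solution ::
    "('a::real_normed_vector \<Rightarrow> 'a) \<Rightarrow> (real \<Rightarrow> 'a) \<Rightarrow> real set \<Rightarrow> bool" where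
  "maximal_solution f x J \<longleftrightarrow>
     solution_on f x J \<and>
     (\<forall>y J'. solution_on f y J' \<and> J \<subseteq> J' \<and> (\<forall>t\<in>J. y t = x t) \<longrightarrow> J' = J)"

definition lyapunov_stable :: "('a::real_normed_vector \<Rightarrow> 'a) \<Rightarrow> 'a \<Rightarrow> bool" where
  "lyapunov_stable f xe \<longleftrightarrow>
     (\<forall>e>0. \<exists>d>0. \<forall>x J. maximal_solution f x J \<and> dist (x 0) xe < d \<longrightarrow>
        (\<forall>t\<in>J. dist (x t) xe < e))"

text \<open>
  By Zorn's lemma every initial condition has a maximal solution (possibly only on \<open>{0}\<close>),
  so the universal quantifier below is never vacuous, and it is meaningful without assuming
  uniqueness of solutions.
\<close>

definition basin_of_attraction :: "('a::real_normed_vector \<Rightarrow> 'a) \<Rightarrow> 'a \<Rightarrow> 'a set" where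
  "basin_of_attraction f xe =
     {x0. \<forall>x J. maximal_solution f x J \<and> x 0 = x0 \<longrightarrow> J = {0..} \<and> (x \<longlongrightarrow> xe) at_top}"

definition asymptotically_stable :: "('a::real_normed_vector \<Rightarrow> 'a) \<Rightarrow> 'a \<Rightarrow> bool" where
  "asymptotically_stable f xe \<longleftrightarrow>
     f xe = 0 \<and> lyapunov_stable f xe \<and>
     (\<exists>U. open U \<and> xe \<in> U \<and> U \<subseteq> basin_of_attraction f xe)"

definition unique_global_solution :: "('a::real_normed_vector \<Rightarrow> 'a) \<Rightarrow> 'a \<Rightarrow> bool" where
  "unique_global_solution f x0 \<longleftrightarrow>
     (\<exists>x. solution_on f x {0..} \<and> x 0 = x0 \<and>
        (\<forall>y. solution_on f y {0..} \<and> y 0 = x0 \<longrightarrow> (\<forall>t\<ge>0. y t = x t)))"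

definition positive_definite :: "real^'n^'n \<Rightarrow> bool" where
  "positive_definite P \<longleftrightarrow> transpose P = P \<and> (\<forall>x. x \<noteq> 0 \<longrightarrow> x \<bullet> (P *v x) > 0)"

definition detectable :: "real^'n^'p \<Rightarrow> real^'n^'n \<Rightarrow> bool" where
  "detectable C A0 \<longleftrightarrow>
     (\<forall>w. solution_on (\<lambda>v. A0 *v v) w {0..} \<and> (\<forall>t\<ge>0. C *v w t = 0) \<longrightarrow>
        (w \<longlongrightarrow> 0) at_top)"

definition feedback_field ::
    "(real^'m \<Rightarrow> real^'n^'n) \<Rightarrow> (real^'m \<Rightarrow> real^'n) \<Rightarrow> (real^'n \<Rightarrow> real^'m) \<Rightarrow>
     real^'n \<Rightarrow> real^'n" where
  "feedback_field A B l x = A (l x) *v x + B (l x)"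

text \<open>The coupled observer/error system, with state \<open>(xh, \<epsilon>)\<close>.\<close>

definition observer_system ::
    "(real^'m \<Rightarrow> real^'n^'n) \<Rightarrow> (real^'m \<Rightarrow> real^'n) \<Rightarrow> real^'n^'p \<Rightarrow> (real^'n \<Rightarrow> real^'m) \<Rightarrow>
     real \<Rightarrow> real^'n^'n \<Rightarrow> (real^'n) \<times> (real^'n) \<Rightarrow> (real^'n) \<times> (real^'n)" where
  "observer_system A B C l \<alpha> P = (\<lambda>(xh, \<epsilon>).
     (A (l xh) *v xh + B (l xh) - (\<alpha> *\<^sub>R (matrix_inv P ** transpose C ** C)) *v \<epsilon>,
      (A (l xh) - \<alpha> *\<^sub>R (matrix_inv P ** transpose C ** C)) *v \<epsilon>))"

end

theory Submission
  imports Defs "HOL-Complex_Analysis.Great_Picard" "HOL-Real_Asymp.Real_Asymp"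
begin

text \<open>
  No converse Lyapunov theorem is needed. Since \<open>f\<close> is continuous with unique solutions,
  solutions of \<open>\<bar>x' - f x\<bar> \<le> \<delta>\<close> stay close to solutions of \<open>x' = f x\<close> on compact time intervals
  (Arzela-Ascoli and uniqueness of the limit). Restarting such estimates in a small ball around the
  stable equilibrium keeps perturbed solutions that start in a compact subset of the basin
  inside a compact subset of the basin for all time.

  Along the observer system, \<open>V(\<epsilon>) = \<epsilon>'P\<epsilon>\<close> has derivative
  \<open>2\<epsilon>'PA(\<lambda>(xh))\<epsilon> - 2\<alpha>\<bar>C\<epsilon>\<bar>\<^sup>2 \<le> 0\<close> as long as \<open>xh\<close> stays in the basin \<open>D\<close> of \<open>f\<close>, so that the
  perturbation \<open>\<alpha>P\<^sup>-\<^sup>1C'C\<epsilon>\<close> is as small as desired, either because \<open>\<alpha>\<close> is small or because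
  \<open>\<epsilon>(0)\<close> is; hence \<open>xh\<close> never leaves a compact subset of \<open>D\<close>. On the omega-limit set
  \<open>V\<close> is constant, so \<open>C\<epsilon> = 0\<close> and \<open>xh\<close> solves \<open>x' = f x\<close> and tends to \<open>0\<close>; on the omega-limit set of such
  a solution \<open>xh = 0\<close> and \<open>\<epsilon>\<close> tends to \<open>0\<close> by detectability. So the trajectory comes arbitrarily close
  to the origin, and Lyapunov stability finishes the proof.
\<close>

section \<open>Solutions of autonomous equations with unique global solutions\<close>

lemma solution_on_D:
  "solution_on f x J \<Longrightarrow> t \<in> J \<Longrightarrow> (x has_vector_derivative f (x t)) (at t within J)"
  unfolding solution_on_def by blast

lemma solution_on_continuous: "solution_on f x J \<Longrightarrow> continuous_on J x"
  unfolding solution_on_def continuous_on_eq_continuous_within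
  using has_vector_derivative_continuous by blast

lemma solution_on_subset:
  "solution_on f x J \<Longrightarrow> is_interval I \<Longrightarrow> 0 \<in> I \<Longrightarrow> I \<subseteq> J \<Longrightarrow> solution_on f x I"
  unfolding solution_on_def by (meson has_vector_derivative_within_subset subset_iff)

lemma solution_on_Icc:
  assumes "solution_on f x J" "T \<in> J"
  shows "solution_on f x {0..T}"
proof (rule solution_on_subset[OF assms(1)])
  show "{0..T} \<subseteq> J"
    using assms unfolding solution_on_def is_interval_1 by auto
  show "0 \<in> {0..T}"
    using assms unfolding solution_on_def by auto
qed (simp add: is_interval_cc)

lemma solution_on_cong:
  assumes "solution_on f x J" "\<And>t. t \<in> J \<Longrightarrow> y t = x t"
  shows "solution_on f y J"
  using assms unfolding solution_on_def
  by (metis has_vector_derivative_transform)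

lemma has_vector_derivative_shift:
  assumes "(x has_vector_derivative v) (at (s + t) within S)"
    and "(\<lambda>r. s + r) ` R \<subseteq> S"
  shows "((\<lambda>r. x (s + r)) has_vector_derivative v) (at t within R)"
proof -
  have "((\<lambda>r. s + r) has_vector_derivative 1) (at t within R)"
    by (auto intro!: derivative_eq_intros)
  moreover have "(x has_vector_derivative v) (at (s + t) within (\<lambda>r. s + r) ` R)"
    using assms has_vector_derivative_within_subset by blast
  ultimately show ?thesis
    using vector_diff_chain_within[of "\<lambda>r. s + r" 1 t R x v] by (simp add: o_def)
qed

lemma solution_on_shift:
  assumes "solution_on f x {0..}" "s \<ge> 0"
  shows "solution_on f (\<lambda>t. x (s + t)) {0..}"
  unfolding solution_on_def
proof (intro conjI ballI)
  fix t :: real assume "t \<in> {0..}"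
  then have "(x has_vector_derivative f (x (s + t))) (at (s + t) within {0..})"
    using assms by (intro solution_on_D) auto
  then show "((\<lambda>t. x (s + t)) has_vector_derivative f (x (s + t))) (at t within {0..})"
    by (rule has_vector_derivative_shift) (use assms in auto)
qed (auto simp: is_interval_ci)

text \<open>The branches meet only at \<open>T\<close>, where both one-sided derivatives equal
  \<open>f (x T)\<close> because \<open>y 0 = x T\<close>. Gluing turns a solution on a bounded
  interval into a global one, to which the uniqueness assumption applies.\<close>

lemma solution_on_concat:
  assumes x: "solution_on f x {0..T}" and T: "0 \<le> T"
    and y: "solution_on f y {0..}" and eq: "y 0 = x T"
  shows "solution_on f (\<lambda>t. if t \<in> {0..T} then x t else y (t - T)) {0..}"
  unfolding solution_on_def
proof (intro conjI ballI)
  fix t :: real assume t: "t \<in> {0..}"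
  have y': "((\<lambda>t. y (t - T)) has_vector_derivative f (y (t - T))) (at t within {T..})"
    if "t \<ge> T" for t
  proof -
    have "(\<lambda>r. - T + r) ` {T..} \<subseteq> {0..}" by auto
    then show ?thesis
      using has_vector_derivative_shift[of y "f (y (t - T))" "-T" t "{0..}" "{T..}"]
        solution_on_D[OF y, of "t - T"] that by simp
  qed
  have u: "{0..} = {0..T} \<union> {T<..}" using T by auto
  have cl: "closure {0..T} \<inter> closure {T<..} = {T}" using T by auto
  have 1: "insert T {0..T} = {0..T}" "insert T {T<..} = {T..}" using T by auto
  have "((\<lambda>t. if t \<in> {0..T} then x t else y (t - T)) has_vector_derivative
     (if t \<in> {0..T} then f (x t) else f (y (t - T)))) (at t within {0..})"
    by (rule has_vector_derivative_If_within_closures[of t "{0..T}" "{T<..}" "{0..}"])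
      (use t T u eq solution_on_D[OF x] y' y'[of T] in \<open>auto simp: 1 cl\<close>)
  then show "((\<lambda>t. if t \<in> {0..T} then x t else y (t - T)) has_vector_derivative
     f (if t \<in> {0..T} then x t else y (t - T))) (at t within {0..})"
    by (simp only: if_distrib[of f])
qed (auto simp: is_interval_ci)

section \<open>Approximate solutions\<close>

text \<open>The defect \<open>v - f (x t)\<close> is merely bounded, with no regularity in time
  imposed, so exact solutions, the estimate driven by the error, and all their restrictions and
  shifts are covered at once. For \<open>T < 0\<close> the condition is empty.\<close>

definition perturbed_solution ::
    "('a::real_normed_vector \<Rightarrow> 'a) \<Rightarrow> real \<Rightarrow> (real \<Rightarrow> 'a) \<Rightarrow> real \<Rightarrow> bool" where
  "perturbed_solution f \<delta> x T \<longleftrightarrow>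
     (\<forall>t\<in>{0..T}. \<exists>v. (x has_vector_derivative v) (at t within {0..T}) \<and> norm (v - f (x t)) \<le> \<delta>)"

lemma perturbed_solution_mono:
  assumes "perturbed_solution f \<delta> x T" "T' \<le> T" "\<delta> \<le> \<delta>'"
  shows "perturbed_solution f \<delta>' x T'"
  unfolding perturbed_solution_def
proof
  fix t assume t: "t \<in> {0..T'}"
  then obtain v where "(x has_vector_derivative v) (at t within {0..T})" "norm (v - f (x t)) \<le> \<delta>"
    using assms unfolding perturbed_solution_def by (meson atLeastAtMost_iff order_trans)
  moreover have "{0..T'} \<subseteq> {0..T}" using assms by auto
  ultimately show "\<exists>v. (x has_vector_derivative v) (at t within {0..T'}) \<and> norm (v - f (x t)) \<le> \<delta>'"
    using assms(3) has_vector_derivative_within_subset by (meson order_trans)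
qed

lemma perturbed_solution_shift:
  assumes "perturbed_solution f \<delta> x T" "0 \<le> s"
  shows "perturbed_solution f \<delta> (\<lambda>t. x (s + t)) (T - s)"
  unfolding perturbed_solution_def
proof
  fix t assume t: "t \<in> {0..T - s}"
  then have "s + t \<in> {0..T}" using assms(2) by auto
  then obtain v where v: "(x has_vector_derivative v) (at (s + t) within {0..T})"
    "norm (v - f (x (s + t))) \<le> \<delta>"
    using assms(1) unfolding perturbed_solution_def by blast
  have "((\<lambda>t. x (s + t)) has_vector_derivative v) (at t within {0..T - s})"
    using v(1) by (rule has_vector_derivative_shift) (use assms(2) in auto)
  then show "\<exists>v. ((\<lambda>t. x (s + t)) has_vector_derivative v) (at t within {0..T - s}) \<and>
      norm (v - f (x (s + t))) \<le> \<delta>"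
    using v(2) by blast
qed

lemma perturbed_solution_continuous:
  "perturbed_solution f \<delta> x T \<Longrightarrow> continuous_on {0..T} x"
  unfolding perturbed_solution_def continuous_on_eq_continuous_within
  using has_vector_derivative_continuous by blast

lemma solution_on_imp_perturbed:
  assumes "solution_on f x {0..}" "0 \<le> \<delta>"
  shows "perturbed_solution f \<delta> x T"
  unfolding perturbed_solution_def
proof
  fix t assume "t \<in> {0..T}"
  then have "(x has_vector_derivative f (x t)) (at t within {0..T})"
    using solution_on_D[OF assms(1), of t] by (auto intro: has_vector_derivative_within_subset)
  then show "\<exists>v. (x has_vector_derivative v) (at t within {0..T}) \<and> norm (v - f (x t)) \<le> \<delta>"
    using assms(2) by (intro exI[of _ "f (x t)"]) auto
qed

text \<open>Mean value inequality: the derivative has norm at most \<open>\<delta>\<close> plus that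
  of \<open>f (y t)\<close>. The common Lipschitz constant later provides equicontinuity.\<close>

lemma perturbed_lipschitz:
  fixes f :: "'a::real_normed_vector \<Rightarrow> 'a"
  assumes y: "perturbed_solution f \<delta> y T"
    and M: "\<And>t. t \<in> {0..T} \<Longrightarrow> norm (f (y t)) \<le> M"
    and "s \<in> {0..T}" "t \<in> {0..T}"
  shows "norm (y s - y t) \<le> (M + \<delta>) * \<bar>s - t\<bar>"
proof -
  obtain v where v: "\<And>t. t \<in> {0..T} \<Longrightarrow> (y has_vector_derivative v t) (at t within {0..T})"
    "\<And>t. t \<in> {0..T} \<Longrightarrow> norm (v t - f (y t)) \<le> \<delta>"
    using y unfolding perturbed_solution_def by metis
  have "norm (y s - y t) \<le> (M + \<delta>) * norm (s - t)"
  proof (rule differentiable_bound[of "{0..T}" y "\<lambda>t h. h *\<^sub>R v t"])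
    show "(y has_derivative (\<lambda>h. h *\<^sub>R v t)) (at t within {0..T})" if "t \<in> {0..T}" for t
      using v(1)[OF that] unfolding has_vector_derivative_def .
    show "onorm (\<lambda>h. h *\<^sub>R v t) \<le> M + \<delta>" if "t \<in> {0..T}" for t
    proof (rule onorm_le)
      fix h :: real
      have "norm (v t) \<le> norm (v t - f (y t)) + norm (f (y t))" by norm
      then have "norm (v t) \<le> M + \<delta>" using v(2)[OF that] M[OF that] by simp
      then show "norm (h *\<^sub>R v t) \<le> (M + \<delta>) * norm h"
        using mult_right_mono[of "norm (v t)" "M + \<delta>" "\<bar>h\<bar>"] by (simp add: mult.commute)
    qed
  qed (use assms in auto)
  then show ?thesis by simp
qed

text \<open>\<open>s\<close> is the least point of the level set \<open>h = e\<close>, which is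
  compact and, by the intermediate value theorem, nonempty. A point before \<open>s\<close> with
  \<open>h > e\<close> would force a crossing strictly before \<open>s\<close>.\<close>

lemma first_crossing:
  fixes h :: "real \<Rightarrow> real"
  assumes "continuous_on {0..T} h" "h 0 < e" "t \<in> {0..T}" "h t \<ge> e"
  obtains s where "s \<in> {0..T}" "h s = e" "\<And>r. 0 \<le> r \<Longrightarrow> r \<le> s \<Longrightarrow> h r \<le> e"
proof -
  define E where "E = {0..T} \<inter> h -` {e}"
  have "continuous_on {0..t} h"
    using assms by (auto intro: continuous_on_subset)
  then obtain r where "0 \<le> r" "r \<le> t" "h r = e"
    using IVT'[of h 0 e t] assms by auto
  then have "r \<in> E" using assms unfolding E_def by auto
  then have "E \<noteq> {}" by blast
  moreover have "closed E"
    unfolding E_def by (intro continuous_closed_preimage assms(1)) auto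
  moreover have "compact E"
  proof -
    have "E = {0..T} \<inter> E" unfolding E_def by auto
    then show ?thesis using \<open>closed E\<close> by (metis compact_Int_closed compact_Icc)
  qed
  ultimately obtain s where s: "s \<in> E" "\<And>r. r \<in> E \<Longrightarrow> s \<le> r"
    using compact_attains_inf by metis
  show thesis
  proof
    show "s \<in> {0..T}" "h s = e" using s unfolding E_def by auto
    fix r assume r: "0 \<le> r" "r \<le> s"
    show "h r \<le> e"
    proof (rule ccontr)
      assume "\<not> h r \<le> e"
      moreover have "continuous_on {0..r} h"
        using assms(1) by (rule continuous_on_subset) (use r \<open>s \<in> {0..T}\<close> in auto)
      ultimately obtain q where q: "0 \<le> q" "q \<le> r" "h q = e"
        using IVT'[of h 0 e r] assms r by auto
      then have "q \<in> E" using r \<open>s \<in> {0..T}\<close> unfolding E_def by auto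
      then have "s \<le> q" by (rule s(2))
      then have "q = r" using q r by simp
      with q \<open>\<not> h r \<le> e\<close> show False by simp
    qed
  qed
qed


section \<open>Flows of continuous fields with unique solutions\<close>

text \<open>Continuity with unique global forward solutions takes the place of a Lipschitz
  condition: dependence on initial data and on perturbations is derived by compactness. Both the
  coupled system and the closed-loop field are instances.\<close>

locale unique_global_flow =
  fixes f :: "'a::euclidean_space \<Rightarrow> 'a"
  assumes cont: "continuous_on UNIV f"
    and global: "\<And>x0. unique_global_solution f x0"
begin

lemma solution_exists: obtains x where "solution_on f x {0..}" "x 0 = x0"
  using global unfolding unique_global_solution_def by blast

lemma solution_unique:
  "solution_on f x {0..} \<Longrightarrow> solution_on f y {0..} \<Longrightarrow> x 0 = y 0 \<Longrightarrow> t \<ge> 0 \<Longrightarrow> x t = y t"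
  using global[of "y 0"] unfolding unique_global_solution_def by metis

text \<open>Continuing \<open>y\<close> beyond \<open>T\<close> by a global solution from
  \<open>y T\<close> makes it global, so uniqueness among global solutions also governs solutions on
  bounded intervals.\<close>

lemma solution_unique_Icc:
  assumes x: "solution_on f x {0..}" and y: "solution_on f y {0..T}" and "x 0 = y 0"
    and t: "t \<in> {0..T}"
  shows "y t = x t"
proof -
  obtain z where z: "solution_on f z {0..}" "z 0 = y T" by (rule solution_exists)
  have "solution_on f (\<lambda>t. if t \<in> {0..T} then y t else z (t - T)) {0..}"
    using t by (intro solution_on_concat y z) auto
  from solution_unique[OF this x, of t] show ?thesis using t assms by auto
qed

text \<open>The global solution with the same initial value agrees with \<open>x\<close> on
  \<open>J\<close>, hence extends it, and maximality forces \<open>J = {0..}\<close>. Stability and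
  basins can therefore be read off global solutions alone.\<close>

lemma maximal_solution_imp_global:
  assumes "maximal_solution f x J"
  shows "J = {0..}" "solution_on f x {0..}"
proof -
  have x: "solution_on f x J" using assms unfolding maximal_solution_def by blast
  obtain X where X: "solution_on f X {0..}" "X 0 = x 0" by (rule solution_exists)
  have "X t = x t" if "t \<in> J" for t
  proof -
    have "t \<ge> 0" using that x unfolding solution_on_def by auto
    then show ?thesis
      using solution_unique_Icc[OF X(1) solution_on_Icc[OF x that] X(2), of t] by simp
  qed
  moreover have "J \<subseteq> {0..}" using x unfolding solution_on_def by blast
  ultimately show "J = {0..}" using assms X(1) unfolding maximal_solution_def by metis
  then show "solution_on f x {0..}" using x by simp
qed

lemma maximal_solution_global:
  assumes "solution_on f x {0..}"
  shows "maximal_solution f x {0..}"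
  using assms unfolding maximal_solution_def by (metis solution_on_def subset_antisym)

lemma lyapunov_stable_iff:
  "lyapunov_stable f xe \<longleftrightarrow> (\<forall>e>0. \<exists>d>0. \<forall>x. solution_on f x {0..} \<and> dist (x 0) xe < d \<longrightarrow>
        (\<forall>t\<ge>0. dist (x t) xe < e))"
proof -
  have "(\<forall>x J. maximal_solution f x J \<and> dist (x 0) xe < d \<longrightarrow> (\<forall>t\<in>J. dist (x t) xe < e))
    \<longleftrightarrow> (\<forall>x. solution_on f x {0..} \<and> dist (x 0) xe < d \<longrightarrow> (\<forall>t\<ge>0. dist (x t) xe < e))" for d e
    using maximal_solution_imp_global maximal_solution_global by (metis atLeast_iff)
  then show ?thesis unfolding lyapunov_stable_def by simp
qed

lemma basin_of_attraction_eq: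
  "basin_of_attraction f xe =
     {x0. \<forall>x. solution_on f x {0..} \<and> x 0 = x0 \<longrightarrow> (x \<longlongrightarrow> xe) at_top}"
  unfolding basin_of_attraction_def
  using maximal_solution_imp_global maximal_solution_global by blast


section \<open>Limits of approximate solutions and closeness on compact intervals\<close>

text \<open>\<open>f\<close> is uniformly continuous on the ball of radius \<open>R\<close>, so the
  derivatives, which differ from \<open>f (y n t)\<close> by at most \<open>\<delta> n\<close>,
  converge uniformly to \<open>f (g t)\<close>.\<close>

lemma solution_limit:
  assumes y: "\<And>n. perturbed_solution f (\<delta> n) (y n) T" and T: "0 \<le> T" and \<delta>: "\<delta> \<longlonglongrightarrow> 0"
    and lim: "uniform_limit {0..T} y g sequentially"
    and bnd: "\<And>n t. t \<in> {0..T} \<Longrightarrow> norm (y n t) \<le> R"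
  shows "solution_on f g {0..T}"
proof -
  have "\<forall>n. \<forall>t\<in>{0..T}. \<exists>v. (y n has_vector_derivative v) (at t within {0..T}) \<and>
      norm (v - f (y n t)) \<le> \<delta> n"
    using y unfolding perturbed_solution_def by blast
  then obtain v where v: "\<And>n t. t \<in> {0..T} \<Longrightarrow> (y n has_vector_derivative v n t) (at t within {0..T})"
    "\<And>n t. t \<in> {0..T} \<Longrightarrow> norm (v n t - f (y n t)) \<le> \<delta> n"
    by metis
  have lim': "(\<lambda>n. y n t) \<longlonglongrightarrow> g t" if "t \<in> {0..T}" for t
    using tendsto_uniform_limitI[OF lim that] .
  have gb: "norm (g t) \<le> R" if "t \<in> {0..T}" for t
    using lim'[OF that] bnd[OF that] by (intro Lim_norm_ubound[OF _ lim'[OF that]]) auto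
  have "uniformly_continuous_on (cball 0 R) f"
    by (intro compact_uniformly_continuous continuous_on_subset[OF cont]) auto
  then have fl: "uniform_limit {0..T} (\<lambda>n t. f (y n t)) (\<lambda>t. f (g t)) sequentially"
    by (rule uniform_limit_compose_uniformly_continuous_on[OF lim]) (use bnd in auto)
  \<comment> \<open>Differentiating the sequence term by term yields its own limit function
    \<open>h\<close>, identified with \<open>g\<close> afterwards by uniqueness of pointwise
    limits.\<close>
  have "\<exists>h. \<forall>t\<in>{0..T}. (\<lambda>n. y n t) \<longlonglongrightarrow> h t \<and>
      (h has_derivative (\<lambda>s. s *\<^sub>R f (g t))) (at t within {0..T})"
  proof (rule has_derivative_sequence[where f' = "\<lambda>n t s. s *\<^sub>R v n t" and ?x0.0 = 0])
    show "(y n has_derivative (\<lambda>s. s *\<^sub>R v n t)) (at t within {0..T})" if "t \<in> {0..T}" for n t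
      using v(1)[OF that] unfolding has_vector_derivative_def .
    show "\<forall>\<^sub>F n in sequentially. \<forall>t\<in>{0..T}. \<forall>h. norm (h *\<^sub>R v n t - h *\<^sub>R f (g t)) \<le> e * norm h"
      if "e > 0" for e
    proof -
      have "\<forall>\<^sub>F n in sequentially. \<forall>t\<in>{0..T}. dist (f (y n t)) (f (g t)) < e/2"
        using uniform_limitD[OF fl, of "e/2"] that by simp
      moreover have "\<forall>\<^sub>F n in sequentially. \<delta> n < e/2"
        using order_tendstoD(2)[OF \<delta>, of "e/2"] that by simp
      ultimately show ?thesis
      proof eventually_elim
        case (elim n)
        show ?case
        proof (intro ballI allI)
          fix t h assume t: "t \<in> {0..T}"
          have "norm (v n t - f (g t)) \<le> norm (v n t - f (y n t)) + norm (f (y n t) - f (g t))"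
            by norm
          also have "\<dots> \<le> e"
            using elim t v(2)[OF t, of n] by (fastforce simp: dist_norm)
          finally have "\<bar>h\<bar> * norm (v n t - f (g t)) \<le> \<bar>h\<bar> * e"
            by (intro mult_left_mono) auto
          then show "norm (h *\<^sub>R v n t - h *\<^sub>R f (g t)) \<le> e * norm h"
            by (simp add: mult.commute flip: scaleR_diff_right)
        qed
      qed
    qed
    show "(\<lambda>n. y n 0) \<longlonglongrightarrow> g 0" using lim' T by simp
  qed (use T in auto)
  then obtain h where h: "\<And>t. t \<in> {0..T} \<Longrightarrow> (\<lambda>n. y n t) \<longlonglongrightarrow> h t"
    "\<And>t. t \<in> {0..T} \<Longrightarrow> (h has_derivative (\<lambda>s. s *\<^sub>R f (g t))) (at t within {0..T})"
    by blast
  have hg: "h t = g t" if "t \<in> {0..T}" for t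
    using LIMSEQ_unique[OF h(1)[OF that] lim'[OF that]] .
  have "solution_on f h {0..T}"
    unfolding solution_on_def has_vector_derivative_def
    using h(2) hg T by (auto simp: is_interval_cc)
  then show ?thesis
    by (rule solution_on_cong) (use hg in auto)
qed

text \<open>By contradiction: counterexamples with \<open>\<delta> n\<close> tending to 0, stopped
  when first at distance \<open>e\<close> from \<open>\<phi>\<close>, have a uniformly convergent
  subsequence by Arzela-Ascoli. The limit solves the equation up to the limiting stopping time, so
  it is \<open>\<phi>\<close>, although the distance at the stopping times is always
  \<open>e\<close>.\<close>

lemma perturbed_close:
  assumes \<phi>: "solution_on f \<phi> {0..}" and T: "0 \<le> T" and e: "0 < e"
  shows "\<exists>\<delta>>0. \<forall>x T'. T' \<le> T \<and> perturbed_solution f \<delta> x T' \<and> dist (x 0) (\<phi> 0) \<le> \<delta> \<longrightarrow>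
           (\<forall>t\<in>{0..T'}. dist (x t) (\<phi> t) < e)"
proof (rule ccontr)
  assume neg: "\<not> ?thesis"
  \<comment> \<open>The second bound makes \<open>\<delta> n < e\<close>, so that each
    counterexample starts inside the tube and has a first crossing; the cap 1 gives the Lipschitz
    constant \<open>M + 1\<close> for all \<open>n\<close>.\<close>
  define \<delta> where "\<delta> n = min 1 (e / (real n + 2))" for n
  have \<delta>pos: "\<delta> n > 0" and \<delta>1: "\<delta> n \<le> 1" and \<delta>e: "\<delta> n < e" for n
  proof -
    show "\<delta> n > 0" "\<delta> n \<le> 1" using e unfolding \<delta>_def by auto
    have "e / (real n + 2) < e / 1" using e by (intro divide_strict_left_mono) auto
    then show "\<delta> n < e" unfolding \<delta>_def by simp
  qed
  have \<delta>0: "\<delta> \<longlonglongrightarrow> 0"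
  proof -
    have "(\<lambda>n. min 1 (e / (real n + 2))) \<longlonglongrightarrow> min 1 0"
      by (intro tendsto_min tendsto_const) real_asymp
    then show ?thesis unfolding \<delta>_def by simp
  qed
  have \<phi>c: "continuous_on {0..} \<phi>" by (rule solution_on_continuous[OF \<phi>])
  have "\<exists>x s. s \<in> {0..T} \<and> perturbed_solution f (\<delta> n) x s \<and> dist (x 0) (\<phi> 0) \<le> \<delta> n \<and>
      dist (x s) (\<phi> s) = e \<and> (\<forall>r\<in>{0..s}. dist (x r) (\<phi> r) \<le> e)" for n
  proof -
    from neg \<delta>pos[of n] obtain x T' t where x: "T' \<le> T" "perturbed_solution f (\<delta> n) x T'"
      "dist (x 0) (\<phi> 0) \<le> \<delta> n" "t \<in> {0..T'}" "\<not> dist (x t) (\<phi> t) < e"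
      by blast
    have "continuous_on {0..T'} (\<lambda>t. dist (x t) (\<phi> t))"
      using perturbed_solution_continuous[OF x(2)] \<phi>c
      by (auto intro!: continuous_intros intro: continuous_on_subset)
    then obtain s where s: "s \<in> {0..T'}" "dist (x s) (\<phi> s) = e"
      "\<And>r. 0 \<le> r \<Longrightarrow> r \<le> s \<Longrightarrow> dist (x r) (\<phi> r) \<le> e"
      by (rule first_crossing[of _ _ e t]) (use x \<delta>e[of n] in auto)
    then show ?thesis
      using x by (intro exI[of _ x] exI[of _ s])
        (auto intro: perturbed_solution_mono[OF x(2)])
  qed
  then obtain x s where xs: "\<And>n. s n \<in> {0..T}" "\<And>n. perturbed_solution f (\<delta> n) (x n) (s n)"
      "\<And>n. dist (x n 0) (\<phi> 0) \<le> \<delta> n" "\<And>n. dist (x n (s n)) (\<phi> (s n)) = e"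
      "\<And>n r. r \<in> {0..s n} \<Longrightarrow> dist (x n r) (\<phi> r) \<le> e"
    by metis
  have "bounded (\<phi> ` {0..T})"
    using \<phi>c by (intro compact_imp_bounded compact_continuous_image)
      (auto intro: continuous_on_subset)
  then obtain R0 where R0: "\<And>t. t \<in> {0..T} \<Longrightarrow> norm (\<phi> t) \<le> R0"
    unfolding bounded_iff by blast
  define R where "R = R0 + e"
  have xR: "norm (x n r) \<le> R" if "r \<in> {0..s n}" for n r
  proof -
    have "r \<in> {0..T}" using that xs(1)[of n] by auto
    moreover have "norm (x n r) \<le> norm (\<phi> r) + dist (x n r) (\<phi> r)" by norm
    ultimately show ?thesis using R0[of r] xs(5)[OF that] unfolding R_def by simp
  qed
  have "compact (f ` cball 0 R)"
    by (intro compact_continuous_image continuous_on_subset[OF cont]) auto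
  then have "bounded (f ` cball 0 R)" by (rule compact_imp_bounded)
  then obtain M where M: "\<And>z. norm z \<le> R \<Longrightarrow> norm (f z) \<le> M"
    unfolding bounded_iff by (metis image_eqI mem_cball_0)
  have "0 \<le> M"
  proof -
    have "norm (x 0 0) \<le> R" by (rule xR) (use xs(1)[of 0] in auto)
    from order_trans[OF norm_ge_zero M[OF this]] show ?thesis .
  qed
  \<comment> \<open>Freezing \<open>x n\<close> after its stopping time puts all functions on the
    common interval \<open>{0..T}\<close> while keeping bound and Lipschitz constant.\<close>
  define y where "y n t = x n (min t (s n))" for n t
  have ylip: "norm (y n t - y n r) \<le> (M + 1) * \<bar>t - r\<bar>" if "t \<in> {0..T}" "r \<in> {0..T}" for n t r
  proof -
    have "norm (y n t - y n r) \<le> (M + \<delta> n) * \<bar>min t (s n) - min r (s n)\<bar>"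
      unfolding y_def
      by (rule perturbed_lipschitz[OF xs(2)]) (use that xs(1)[of n] in \<open>auto intro!: M xR\<close>)
    also have "\<dots> \<le> (M + 1) * \<bar>t - r\<bar>"
      using \<delta>1[of n] \<delta>pos[of n] \<open>0 \<le> M\<close> by (intro mult_mono) auto
    finally show ?thesis .
  qed
  have yR: "norm (y n t) \<le> R" if "t \<in> {0..T}" for n t
    unfolding y_def by (rule xR) (use that xs(1)[of n] in auto)
  have "\<exists>d>0. \<forall>n t. t \<in> {0..T} \<and> norm (r - t) < d \<longrightarrow> norm (y n r - y n t) < e'"
    if "r \<in> {0..T}" "0 < e'" for r e'
  proof (intro exI conjI allI impI)
    show "0 < e' / (M + 1)" using that \<open>0 \<le> M\<close> by simp
    fix n t assume t: "t \<in> {0..T} \<and> norm (r - t) < e' / (M + 1)"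
    then have "norm (y n r - y n t) \<le> (M + 1) * \<bar>r - t\<bar>" using that by (intro ylip) auto
    also have "\<dots> < e'" using t \<open>0 \<le> M\<close> by (simp add: field_simps)
    finally show "norm (y n r - y n t) < e'" .
  qed
  with yR obtain g k where g: "continuous_on {0..T} g" and k: "strict_mono (k :: nat \<Rightarrow> nat)"
    and kl: "\<And>e. 0 < e \<Longrightarrow> \<exists>N. \<forall>n t. n \<ge> N \<and> t \<in> {0..T} \<longrightarrow> norm (y (k n) t - g t) < e"
    by (rule Arzela_Ascoli[of "{0..T}" y R, OF compact_Icc]) blast+
  \<comment> \<open>A second extraction makes the stopping times converge too; \<open>m\<close> is
    the composed subsequence.\<close>
  obtain s' q where s': "s' \<in> {0..T}" "strict_mono (q :: nat \<Rightarrow> nat)" "(\<lambda>n. s (k (q n))) \<longlonglongrightarrow> s'"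
  proof -
    have "\<forall>n. s (k n) \<in> {0..T}" using xs(1) by blast
    with compact_imp_seq_compact[OF compact_Icc[of 0 T]] show thesis
      by (rule seq_compactE) (use that in \<open>simp add: o_def\<close>)
  qed
  define m where "m = k \<circ> q"
  have m: "strict_mono m" unfolding m_def using k s'(2) by (rule strict_mono_o)
  have ul: "uniform_limit {0..T} (\<lambda>n. y (m n)) g sequentially"
    unfolding uniform_limit_sequentially_iff m_def o_def dist_norm
    using kl seq_suble[OF s'(2)] by (meson order_trans)
  have sm: "(\<lambda>n. s (m n)) \<longlonglongrightarrow> s'" using s'(3) unfolding m_def by simp
  have \<delta>m: "(\<lambda>n. \<delta> (m n)) \<longlonglongrightarrow> 0"
    using LIMSEQ_subseq_LIMSEQ[OF \<delta>0 m] by (simp add: o_def)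
  have g0: "g 0 = \<phi> 0"
  proof (rule LIMSEQ_unique)
    show "(\<lambda>n. y (m n) 0) \<longlonglongrightarrow> g 0" by (rule tendsto_uniform_limitI[OF ul]) (use T in auto)
    have "y n 0 = x n 0" for n using xs(1)[of n] unfolding y_def by simp
    then have "\<forall>n. dist (y (m n) 0) (\<phi> 0) \<le> \<delta> (m n)" using xs(3) by simp
    then show "(\<lambda>n. y (m n) 0) \<longlonglongrightarrow> \<phi> 0"
      using \<delta>m by (intro metric_tendsto_imp_tendsto[OF \<delta>m]) (auto simp: dist_real_def intro!: always_eventually order_trans[OF _ abs_ge_self])
  qed
  have before: "g \<sigma> = \<phi> \<sigma>" if "0 \<le> \<sigma>" "\<sigma> < s'" for \<sigma>
  proof -
    obtain N where N: "\<And>n. n \<ge> N \<Longrightarrow> \<sigma> < s (m n)"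
      using order_tendstoD(1)[OF sm \<open>\<sigma> < s'\<close>] unfolding eventually_sequentially by blast
    have sub: "{0..\<sigma>} \<subseteq> {0..T}" using that s'(1) by auto
    have "solution_on f g {0..\<sigma>}"
    proof (rule solution_limit[where y = "\<lambda>n. y (m (n + N))" and \<delta> = "\<lambda>n. \<delta> (m (n + N))"])
      show "perturbed_solution f (\<delta> (m (n + N))) (y (m (n + N))) \<sigma>" for n
      proof -
        have "perturbed_solution f (\<delta> (m (n + N))) (x (m (n + N))) \<sigma>"
          by (rule perturbed_solution_mono[OF xs(2)]) (use N[of "n + N"] in auto)
        moreover have "y (m (n + N)) t = x (m (n + N)) t" if "t \<in> {0..\<sigma>}" for t
          using that N[of "n + N"] unfolding y_def by (simp add: min_def)
        ultimately show ?thesis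
          unfolding perturbed_solution_def by (metis has_vector_derivative_transform)
      qed
      show "(\<lambda>n. \<delta> (m (n + N))) \<longlonglongrightarrow> 0" by (rule LIMSEQ_ignore_initial_segment[OF \<delta>m])
      show "uniform_limit {0..\<sigma>} (\<lambda>n. y (m (n + N))) g sequentially"
        using uniform_limit_on_subset[OF ul sub] unfolding uniform_limit_sequentially_iff
        by (meson le_add1 order_trans)
      show "norm (y (m (n + N)) t) \<le> R" if "t \<in> {0..\<sigma>}" for n t
        by (rule yR) (use that sub in blast)
    qed (use that in auto)
    then show ?thesis
      using solution_unique_Icc[OF \<phi>, of g \<sigma> \<sigma>] g0 that by simp
  qed
  have gs: "g s' = \<phi> s'"
  proof (cases "s' = 0")
    case False
    then have cl: "closure {0..<s'} = {0..s'}" using s'(1) by simp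
    have "continuous_on {0..s'} g" "continuous_on {0..s'} \<phi>"
      using s'(1) by (auto intro: continuous_on_subset[OF g] continuous_on_subset[OF \<phi>c])
    then have "continuous_on (closure {0..<s'}) (\<lambda>t. g t - \<phi> t)"
      unfolding cl by (rule continuous_on_diff)
    then have "g s' - \<phi> s' = 0"
    proof (rule continuous_constant_on_closure)
      show "g t - \<phi> t = 0" if "t \<in> {0..<s'}" for t using before[of t] that by simp
      show "s' \<in> closure {0..<s'}" unfolding cl using s'(1) by simp
    qed
    then show ?thesis by simp
  qed (use g0 in simp)
  \<comment> \<open>Uniform convergence permits evaluation at the moving times
    \<open>s (m n)\<close>; with \<open>g s' = \<phi> s'\<close> the distance to
    \<open>\<phi>\<close> at these times tends to 0, while it equals \<open>e\<close>.\<close>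
  have "(\<lambda>n. y (m n) (s (m n)) - g (s (m n))) \<longlonglongrightarrow> 0"
    unfolding LIMSEQ_def
  proof (intro allI impI)
    fix r :: real assume "0 < r"
    then obtain N where "\<forall>n\<ge>N. \<forall>t\<in>{0..T}. dist (y (m n) t) (g t) < r"
      using ul unfolding uniform_limit_sequentially_iff by blast
    then have "\<forall>n\<ge>N. dist (y (m n) (s (m n))) (g (s (m n))) < r" using xs(1) by blast
    then show "\<exists>N. \<forall>n\<ge>N. dist (y (m n) (s (m n)) - g (s (m n))) 0 < r"
      by (auto simp: dist_norm)
  qed
  moreover have "(\<lambda>n. g (s (m n)) - \<phi> (s (m n))) \<longlonglongrightarrow> g s' - \<phi> s'"
    using xs(1) s'(1) continuous_on_subset[OF \<phi>c, of "{0..T}"]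
    by (intro tendsto_diff continuous_on_tendsto_compose[OF _ sm, of "{0..T}"] g) auto
  ultimately have "(\<lambda>n. y (m n) (s (m n)) - \<phi> (s (m n))) \<longlonglongrightarrow> 0"
    using tendsto_add[of "\<lambda>n. y (m n) (s (m n)) - g (s (m n))" 0 sequentially
        "\<lambda>n. g (s (m n)) - \<phi> (s (m n))" "g s' - \<phi> s'"] gs by simp
  then have "(\<lambda>n. norm (y (m n) (s (m n)) - \<phi> (s (m n)))) \<longlonglongrightarrow> 0"
    by (rule tendsto_norm_zero)
  moreover have "norm (y (m n) (s (m n)) - \<phi> (s (m n))) = e" for n
    using xs(4)[of "m n"] unfolding y_def by (simp add: dist_norm)
  ultimately show False
    using e by (simp add: LIMSEQ_const_iff)
qed


section \<open>Total stability and confinement in the basin\<close>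

text \<open>A thin tube around each orbit arc stays in \<open>W\<close> and ends in
  \<open>G\<close>, and captures perturbed solutions starting nearby; a finite subcover of
  \<open>K\<close> makes \<open>\<delta>\<close> and \<open>L\<close> uniform. The bound
  \<open>1 \<le> T\<close> lets later restarts be counted, and the minimum with \<open>T'\<close>
  covers solutions that end before \<open>T\<close>.\<close>

lemma perturbed_reach_compact:
  assumes K: "compact K" and W: "open W" and G: "open G"
    and reach: "\<And>x0. x0 \<in> K \<Longrightarrow> \<exists>\<phi> T. solution_on f \<phi> {0..} \<and> \<phi> 0 = x0 \<and> 1 \<le> T \<and>
                   \<phi> ` {0..T} \<subseteq> W \<and> \<phi> T \<in> G"
  shows "\<exists>\<delta>>0. \<exists>L. compact L \<and> L \<subseteq> W \<and>
           (\<forall>x T'. 0 \<le> T' \<and> perturbed_solution f \<delta> x T' \<and> x 0 \<in> K \<longrightarrow>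
              (\<exists>T\<ge>1. (\<forall>t\<in>{0..min T T'}. x t \<in> L) \<and> (T \<le> T' \<longrightarrow> x T \<in> G)))"
proof -
  define Q where "Q x0 \<delta> L T \<longleftrightarrow> \<delta> > 0 \<and> compact L \<and> L \<subseteq> W \<and> 1 \<le> T \<and>
      (\<forall>x T'. 0 \<le> T' \<and> perturbed_solution f \<delta> x T' \<and> dist (x 0) x0 < \<delta> \<longrightarrow>
        (\<forall>t\<in>{0..min T T'}. x t \<in> L) \<and> (T \<le> T' \<longrightarrow> x T \<in> G))" for x0 \<delta> L T
  have "\<exists>\<delta> L T. Q x0 \<delta> L T" if "x0 \<in> K" for x0
  proof -
    from reach[OF that] obtain \<phi> T where \<phi>: "solution_on f \<phi> {0..}" "\<phi> 0 = x0" "1 \<le> T"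
      "\<phi> ` {0..T} \<subseteq> W" "\<phi> T \<in> G" by blast
    have cp: "compact (\<phi> ` {0..T})"
      by (intro compact_continuous_image continuous_on_subset[OF solution_on_continuous[OF \<phi>(1)]]) auto
    obtain e1 where e1: "e1 > 0" "(\<Union>z\<in>\<phi> ` {0..T}. ball z e1) \<subseteq> W"
      using compact_subset_open_imp_ball_epsilon_subset[OF cp W \<phi>(4)] by blast
    obtain e2 where e2: "e2 > 0" "ball (\<phi> T) e2 \<subseteq> G"
      using G \<phi>(5) open_contains_ball by blast
    define e where "e = min (e1 / 2) e2"
    have e: "e > 0" using e1 e2 unfolding e_def by simp
    \<comment> \<open>The closed \<open>e\<close>-neighbourhood of the arc, written as a Minkowski
      sum of compact sets; halving \<open>e1\<close> keeps it inside the open tube contained in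
      \<open>W\<close>.\<close>
    define L where "L = {z + h |z h. z \<in> \<phi> ` {0..T} \<and> h \<in> cball 0 e}"
    have "compact L" unfolding L_def by (intro compact_sums cp compact_cball)
    moreover have "L \<subseteq> W"
    proof
      fix p assume "p \<in> L"
      then obtain z h where "p = z + h" "z \<in> \<phi> ` {0..T}" "norm h \<le> e" unfolding L_def by auto
      moreover from this have "p \<in> ball z e1" using e1(1) unfolding e_def by (simp add: dist_norm)
      ultimately show "p \<in> W" using e1(2) by blast
    qed
    moreover obtain \<delta> where \<delta>: "\<delta> > 0"
      "\<And>x T'. T' \<le> T \<Longrightarrow> perturbed_solution f \<delta> x T' \<Longrightarrow> dist (x 0) x0 \<le> \<delta> \<Longrightarrow>
           (\<forall>t\<in>{0..T'}. dist (x t) (\<phi> t) < e)"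
      using perturbed_close[OF \<phi>(1) _ e, of T] \<phi>(2,3) by auto
    moreover have "(\<forall>t\<in>{0..min T T'}. x t \<in> L) \<and> (T \<le> T' \<longrightarrow> x T \<in> G)"
      if x: "0 \<le> T'" "perturbed_solution f \<delta> x T'" "dist (x 0) x0 < \<delta>" for x T'
    proof -
      have "perturbed_solution f \<delta> x (min T T')"
        by (rule perturbed_solution_mono[OF x(2)]) auto
      then have near: "dist (x t) (\<phi> t) < e" if "t \<in> {0..min T T'}" for t
        using \<delta>(2)[of "min T T'" x] x(3) that by auto
      have "x t \<in> L" if "t \<in> {0..min T T'}" for t
        unfolding L_def using near[OF that] that
        by (intro CollectI exI[of _ "\<phi> t"] exI[of _ "x t - \<phi> t"]) (auto simp: dist_norm norm_minus_commute)
      moreover have "x T \<in> G" if "T \<le> T'"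
        using near[of T] that \<phi>(3) e2(2) unfolding e_def by (auto simp: dist_commute)
      ultimately show ?thesis by blast
    qed
    ultimately have "Q x0 \<delta> L T" unfolding Q_def using \<phi>(3) by blast
    then show ?thesis by blast
  qed
  then obtain \<delta> L T where "\<And>x0. x0 \<in> K \<Longrightarrow> Q x0 (\<delta> x0) (L x0) (T x0)"
    by metis
  then have *: "\<And>x0. x0 \<in> K \<Longrightarrow> \<delta> x0 > 0" "\<And>x0. x0 \<in> K \<Longrightarrow> compact (L x0)"
    "\<And>x0. x0 \<in> K \<Longrightarrow> L x0 \<subseteq> W" "\<And>x0. x0 \<in> K \<Longrightarrow> 1 \<le> T x0"
    "\<And>x0 x T'. x0 \<in> K \<Longrightarrow> 0 \<le> T' \<Longrightarrow> perturbed_solution f (\<delta> x0) x T' \<Longrightarrow> dist (x 0) x0 < \<delta> x0 \<Longrightarrow>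
       (\<forall>t\<in>{0..min (T x0) T'}. x t \<in> L x0) \<and> (T x0 \<le> T' \<longrightarrow> x (T x0) \<in> G)"
    unfolding Q_def by blast+
  obtain F where F: "F \<subseteq> K" "finite F" "K \<subseteq> (\<Union>x0\<in>F. ball x0 (\<delta> x0))"
    by (rule compactE_image[OF K, of K "\<lambda>x0. ball x0 (\<delta> x0)"]) (use *(1) in auto)
  \<comment> \<open>The inserted 1 keeps the minimum defined when the subcover is empty.\<close>
  define d where "d = Min (insert 1 (\<delta> ` F))"
  have d: "d > 0" "\<And>x0. x0 \<in> F \<Longrightarrow> d \<le> \<delta> x0"
    using F *(1) unfolding d_def by auto
  show ?thesis
  proof (rule exI[of _ d], rule conjI[OF d(1)], rule exI[of _ "\<Union>x0\<in>F. L x0"],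
      intro conjI allI impI)
    show "compact (\<Union>x0\<in>F. L x0)" using F *(2) by (intro compact_UN) auto
    show "(\<Union>x0\<in>F. L x0) \<subseteq> W" using F *(3) by auto
    fix x T' assume x: "0 \<le> T' \<and> perturbed_solution f d x T' \<and> x 0 \<in> K"
    then obtain x0 where x0: "x0 \<in> F" "dist (x 0) x0 < \<delta> x0"
      using F(3) by (auto simp: dist_commute)
    then have "perturbed_solution f (\<delta> x0) x T'"
      using x d(2) perturbed_solution_mono by blast
    then show "\<exists>T\<ge>1. (\<forall>t\<in>{0..min T T'}. x t \<in> (\<Union>x0\<in>F. L x0)) \<and> (T \<le> T' \<longrightarrow> x T \<in> G)"
      using *(4)[of x0] *(5)[of x0 T' x] x x0 F(1) by (intro exI[of _ "T x0"]) blast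
  qed
qed

text \<open>Unperturbed solutions from the closed ball of radius \<open>d\<close> remain within
  \<open>e\<close> and return to the open ball of radius \<open>d\<close> after a time at least 1.
  Perturbed ones inherit this for one lap, and the lap can be repeated from its endpoint.\<close>

lemma total_stability:
  assumes as: "asymptotically_stable f xe" and e: "0 < e"
  shows "\<exists>d>0. \<exists>\<delta>>0. \<forall>x T. perturbed_solution f \<delta> x T \<and> dist (x 0) xe \<le> d \<longrightarrow>
            (\<forall>t\<in>{0..T}. dist (x t) xe < e)"
proof -
  obtain U where U: "open U" "xe \<in> U" "U \<subseteq> basin_of_attraction f xe"
    using as unfolding asymptotically_stable_def by blast
  then obtain r where r: "r > 0" "cball xe r \<subseteq> U" using open_contains_cball by blast
  obtain d0 where d0: "d0 > 0"
    "\<And>x t. solution_on f x {0..} \<Longrightarrow> dist (x 0) xe < d0 \<Longrightarrow> t \<ge> 0 \<Longrightarrow> dist (x t) xe < e"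
    using as e unfolding asymptotically_stable_def lyapunov_stable_iff by meson
  \<comment> \<open>\<open>r\<close> places the closed ball in the basin, so its points return;
    \<open>d0\<close> is the Lyapunov threshold for \<open>e\<close>, halved to allow the closed
    ball.\<close>
  define d where "d = min r (d0 / 2)"
  have d: "0 < d" "d \<le> r" "d < d0" using r d0(1) unfolding d_def by auto
  have "\<exists>\<phi> T. solution_on f \<phi> {0..} \<and> \<phi> 0 = x0 \<and> 1 \<le> T \<and> \<phi> ` {0..T} \<subseteq> ball xe e \<and> \<phi> T \<in> ball xe d"
    if x0: "x0 \<in> cball xe d" for x0
  proof -
    obtain \<phi> where \<phi>: "solution_on f \<phi> {0..}" "\<phi> 0 = x0" by (rule solution_exists)
    have "x0 \<in> cball xe r" using x0 d by auto
    then have "x0 \<in> basin_of_attraction f xe" using r U by blast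
    then have "(\<phi> \<longlongrightarrow> xe) at_top" using \<phi> unfolding basin_of_attraction_eq by blast
    then have "eventually (\<lambda>t. dist (\<phi> t) xe < d) at_top" using d tendstoD by blast
    then obtain T where T: "\<And>t. t \<ge> T \<Longrightarrow> dist (\<phi> t) xe < d"
      unfolding eventually_at_top_linorder by blast
    have "dist (\<phi> t) xe < e" if "t \<ge> 0" for t
      using d0(2)[OF \<phi>(1) _ that] \<phi>(2) x0 d by (simp add: dist_commute)
    then show ?thesis
      using \<phi> T[of "max 1 T"] by (intro exI[of _ \<phi>] exI[of _ "max 1 T"]) (auto simp: dist_commute)
  qed
  with perturbed_reach_compact[of "cball xe d" "ball xe e" "ball xe d"]
  obtain \<delta> L where \<delta>: "\<delta> > 0" "L \<subseteq> ball xe e" and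
    step': "\<forall>x T'. 0 \<le> T' \<and> perturbed_solution f \<delta> x T' \<and> x 0 \<in> cball xe d \<longrightarrow>
              (\<exists>T\<ge>1. (\<forall>t\<in>{0..min T T'}. x t \<in> L) \<and> (T \<le> T' \<longrightarrow> x T \<in> ball xe d))"
    by (metis compact_cball open_ball)
  have step: "\<exists>T\<ge>1. (\<forall>t\<in>{0..min T T'}. x t \<in> L) \<and> (T \<le> T' \<longrightarrow> x T \<in> ball xe d)"
    if "0 \<le> T'" "perturbed_solution f \<delta> x T'" "dist (x 0) xe \<le> d" for x T'
    using step' that by (simp add: dist_commute)
  \<comment> \<open>Induction on an integer bound for the duration: each lap lasts
    \<open>S \<ge> 1\<close>, so the restarted solution has duration at most
    \<open>n\<close>.\<close>
  have stay: "\<forall>t\<in>{0..T}. dist (x t) xe < e"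
    if "T \<le> real n" "perturbed_solution f \<delta> x T" "dist (x 0) xe \<le> d" for n x T
    using that
  proof (induction n arbitrary: x T)
    case 0
    show ?case
    proof
      fix t assume t: "t \<in> {0..T}"
      with 0 have "T = 0" "t = 0" by auto
      then show "dist (x t) xe < e"
        using step[of 0 x] 0 \<delta>(2) by (auto simp: dist_commute subset_iff)
    qed
  next
    case (Suc n)
    show ?case
    proof
      fix t assume t: "t \<in> {0..T}"
      obtain S where S: "S \<ge> 1" "\<And>t. t \<in> {0..min S T} \<Longrightarrow> x t \<in> L" "S \<le> T \<Longrightarrow> x S \<in> ball xe d"
        using step[of T x] Suc.prems t by auto
      show "dist (x t) xe < e"
      proof (cases "t \<le> S")
        case True
        then have "x t \<in> ball xe e" using S(2)[of t] t \<delta>(2) by auto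
        then show ?thesis by (simp add: dist_commute)
      next
        case False
        have "perturbed_solution f \<delta> (\<lambda>r. x (S + r)) (T - S)"
          using Suc.prems(2) S(1) by (intro perturbed_solution_shift) auto
        moreover have "dist (x (S + 0)) xe \<le> d" using S(3) False t by (auto simp: dist_commute)
        moreover have "T - S \<le> real n" using Suc.prems(1) S(1) by simp
        ultimately have "\<forall>r\<in>{0..T - S}. dist (x (S + r)) xe < e"
          by (intro Suc.IH)
        from bspec[OF this, of "t - S"] show ?thesis using False t by simp
      qed
    qed
  qed
  have "\<forall>x T. perturbed_solution f \<delta> x T \<and> dist (x 0) xe \<le> d \<longrightarrow> (\<forall>t\<in>{0..T}. dist (x t) xe < e)"
    using stay real_arch_simple by blast
  then show ?thesis using d(1) \<delta>(1) by blast
qed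

text \<open>By uniqueness every solution from \<open>x t\<close> is a tail of \<open>x\<close> and
  has the same limit.\<close>

lemma basin_forward_invariant:
  assumes "solution_on f x {0..}" "x 0 \<in> basin_of_attraction f xe" "0 \<le> t"
  shows "x t \<in> basin_of_attraction f xe"
  unfolding basin_of_attraction_eq
proof (intro CollectI allI impI)
  fix y assume y: "solution_on f y {0..} \<and> y 0 = x t"
  have "y s = x (t + s)" if "s \<ge> 0" for s
    using solution_unique[of y "\<lambda>s. x (t + s)" s] y solution_on_shift[OF assms(1,3)] that by simp
  then have "\<forall>\<^sub>F s in at_top. x (t + s) = y s"
    by (auto intro: eventually_at_top_linorderI[of 0])
  moreover have "(x \<longlongrightarrow> xe) at_top" using assms unfolding basin_of_attraction_eq by blast
  then have "((\<lambda>s. x (t + s)) \<longlongrightarrow> xe) at_top"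
    by (rule filterlim_compose) (rule filterlim_tendsto_add_at_top[OF tendsto_const filterlim_ident])
  ultimately show "(y \<longlongrightarrow> xe) at_top" using Lim_transform_eventually by blast
qed

text \<open>Compactness of \<open>K\<close> brings all perturbed solutions close to the equilibrium
  along a compact part of the basin; from then on total stability holds them in a ball, for as long
  as they last.\<close>

lemma perturbed_confined:
  assumes as: "asymptotically_stable f xe" and D: "open (basin_of_attraction f xe)"
    and K: "compact K" "K \<subseteq> basin_of_attraction f xe"
  shows "\<exists>\<delta>>0. \<exists>L. compact L \<and> L \<subseteq> basin_of_attraction f xe \<and>
            (\<forall>x T. perturbed_solution f \<delta> x T \<and> x 0 \<in> K \<longrightarrow> (\<forall>t\<in>{0..T}. x t \<in> L))"
proof -
  let ?D = "basin_of_attraction f xe"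
  have "xe \<in> ?D" using as unfolding asymptotically_stable_def by blast
  then obtain e where e: "e > 0" "cball xe e \<subseteq> ?D" using D open_contains_cball by blast
  from total_stability[OF as e(1)]
  obtain d \<delta>1 where d: "d > 0" "\<delta>1 > 0"
    "\<And>x T. perturbed_solution f \<delta>1 x T \<Longrightarrow> dist (x 0) xe \<le> d \<Longrightarrow> \<forall>t\<in>{0..T}. dist (x t) xe < e"
    by blast
  have "\<exists>\<phi> T. solution_on f \<phi> {0..} \<and> \<phi> 0 = x0 \<and> 1 \<le> T \<and> \<phi> ` {0..T} \<subseteq> ?D \<and> \<phi> T \<in> ball xe d"
    if x0: "x0 \<in> K" for x0
  proof -
    obtain \<phi> where \<phi>: "solution_on f \<phi> {0..}" "\<phi> 0 = x0" by (rule solution_exists)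
    have "x0 \<in> ?D" using x0 K by auto
    then have "(\<phi> \<longlongrightarrow> xe) at_top" using \<phi> unfolding basin_of_attraction_eq by blast
    then have "eventually (\<lambda>t. dist (\<phi> t) xe < d) at_top" using d tendstoD by blast
    then obtain T where T: "\<And>t. t \<ge> T \<Longrightarrow> dist (\<phi> t) xe < d"
      unfolding eventually_at_top_linorder by blast
    have "\<phi> t \<in> ?D" if "t \<ge> 0" for t
      using basin_forward_invariant[OF \<phi>(1) _ that] \<phi>(2) \<open>x0 \<in> ?D\<close> by simp
    then show ?thesis
      using \<phi> T[of "max 1 T"] by (intro exI[of _ \<phi>] exI[of _ "max 1 T"]) (auto simp: dist_commute)
  qed
  from perturbed_reach_compact[OF K(1) D open_ball this]
  obtain \<delta>2 L where \<delta>2: "\<delta>2 > 0" "compact L" "L \<subseteq> ?D" and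
    step: "\<And>x T'. 0 \<le> T' \<Longrightarrow> perturbed_solution f \<delta>2 x T' \<Longrightarrow> x 0 \<in> K \<Longrightarrow>
              \<exists>T\<ge>1. (\<forall>t\<in>{0..min T T'}. x t \<in> L) \<and> (T \<le> T' \<longrightarrow> x T \<in> ball xe d)"
    by blast
  show ?thesis
  proof (intro exI conjI allI impI ballI)
    show "min \<delta>1 \<delta>2 > 0" using d \<delta>2 by simp
    show "compact (L \<union> cball xe e)" using \<delta>2 by (intro compact_Un) auto
    show "L \<union> cball xe e \<subseteq> ?D" using \<delta>2 e by auto
    fix x T t assume x: "perturbed_solution f (min \<delta>1 \<delta>2) x T \<and> x 0 \<in> K" and t: "t \<in> {0..T}"
    have x1: "perturbed_solution f \<delta>1 x T" and x2: "perturbed_solution f \<delta>2 x T"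
      using x perturbed_solution_mono by (metis min.cobounded1 order_refl, metis min.cobounded2 order_refl)
    obtain S where S: "S \<ge> 1" "\<And>t. t \<in> {0..min S T} \<Longrightarrow> x t \<in> L" "S \<le> T \<Longrightarrow> x S \<in> ball xe d"
      using step[of T x] x x2 t by auto
    show "x t \<in> L \<union> cball xe e"
    proof (cases "t \<le> S")
      case True
      then show ?thesis using S(2)[of t] t by auto
    next
      case False
      have "perturbed_solution f \<delta>1 (\<lambda>r. x (S + r)) (T - S)"
        using x1 S(1) by (intro perturbed_solution_shift) auto
      moreover have "dist (x (S + 0)) xe \<le> d" using S(3) False t by (auto simp: dist_commute)
      ultimately have "\<forall>r\<in>{0..T - S}. dist (x (S + r)) xe < e"
        by (intro d(3))
      from bspec[OF this, of "t - S"] show ?thesis using False t by (simp add: dist_commute)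
    qed
  qed
qed

section \<open>Omega-limit solutions\<close>

text \<open>Samples of \<open>z\<close> at integer times have a convergent subsequence;
  \<open>w\<close> is the solution from its limit, and continuous dependence carries the convergence
  to every later \<open>t\<close>.\<close>

lemma omega_limit_solution:
  assumes z: "solution_on f z {0..}" and bnd: "bounded (z ` {0..})"
  obtains w \<tau> where "solution_on f w {0..}" "filterlim \<tau> at_top sequentially" "\<And>n. \<tau> n \<ge> 0"
    "\<And>t. t \<ge> 0 \<Longrightarrow> (\<lambda>n. z (\<tau> n + t)) \<longlonglongrightarrow> w t"
proof -
  have "bounded (range (\<lambda>n. z (real n)))" by (rule bounded_subset[OF bnd]) auto
  then obtain l r where r: "strict_mono (r :: nat \<Rightarrow> nat)" "((\<lambda>n. z (real n)) \<circ> r) \<longlonglongrightarrow> l"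
    using bounded_imp_convergent_subsequence by blast
  obtain w where w: "solution_on f w {0..}" "w 0 = l" by (rule solution_exists)
  show thesis
  proof
    show "solution_on f w {0..}" by fact
    show "filterlim (\<lambda>n. real (r n)) at_top sequentially"
      by (rule filterlim_compose[OF filterlim_real_sequentially filterlim_subseq[OF r(1)]])
    show "(\<lambda>n. z (real (r n) + t)) \<longlonglongrightarrow> w t" if t: "t \<ge> 0" for t
    proof (rule tendstoI)
      fix e :: real assume "e > 0"
      from perturbed_close[OF w(1) t this]
      obtain \<delta> where \<delta>: "\<delta> > 0" "\<And>x T'. T' \<le> t \<Longrightarrow> perturbed_solution f \<delta> x T' \<Longrightarrow>
          dist (x 0) (w 0) \<le> \<delta> \<Longrightarrow> (\<forall>t\<in>{0..T'}. dist (x t) (w t) < e)" by blast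
      have "\<forall>\<^sub>F n in sequentially. dist (z (real (r n))) l < \<delta>"
        using tendstoD[OF r(2) \<delta>(1)] by simp
      then show "\<forall>\<^sub>F n in sequentially. dist (z (real (r n) + t)) (w t) < e"
      proof eventually_elim
        case (elim n)
        \<comment> \<open>Exact solutions count as perturbed ones, so closeness serves here as
          continuous dependence on the initial state.\<close>
        have "perturbed_solution f \<delta> (\<lambda>s. z (real (r n) + s)) t"
          using \<delta>(1) by (intro solution_on_imp_perturbed solution_on_shift[OF z]) auto
        then show ?case using \<delta>(2)[of t "\<lambda>s. z (real (r n) + s)"] elim w(2) t by auto
      qed
    qed
  qed auto
qed

end

lemma at_within_atLeast: "a < t \<Longrightarrow> at t within {a..} = at t" for a t :: real
  by (rule at_within_interior) simp

text \<open>The monotonicity step of the LaSalle principle: since \<open>\<tau> k + s\<close>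
  eventually exceeds \<open>\<tau> n + t\<close>, the limit value at \<open>s\<close> lies below
  every \<open>h (z (\<tau> n + t))\<close>, hence below the limit value at
  \<open>t\<close>.\<close>

lemma omega_limit_constant:
  fixes h :: "'a::topological_space \<Rightarrow> real" and \<tau> :: "nat \<Rightarrow> real"
  assumes lim: "\<And>t. t \<ge> 0 \<Longrightarrow> (\<lambda>n. z (\<tau> n + t)) \<longlonglongrightarrow> w t"
    and \<tau>: "filterlim \<tau> at_top sequentially" "\<And>n. \<tau> n \<ge> 0"
    and h: "continuous_on UNIV h" and mono: "\<And>s t. 0 \<le> s \<Longrightarrow> s \<le> t \<Longrightarrow> h (z t) \<le> h (z s)"
    and s: "0 \<le> s" and t: "s \<le> t"
  shows "h (w t) = h (w s)"
proof (rule antisym)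
  have hl: "(\<lambda>n. h (z (\<tau> n + r))) \<longlonglongrightarrow> h (w r)" if "r \<ge> 0" for r
    by (rule continuous_on_tendsto_compose[OF h lim[OF that]]) auto
  show "h (w t) \<le> h (w s)"
    using s t \<tau>(2) by (intro LIMSEQ_le[OF hl[of t] hl[of s]] exI[of _ 0] allI impI mono)
      auto
  have "h (w s) \<le> h (z (\<tau> n + t))" for n
  proof (rule tendsto_upperbound[OF hl[OF s]])
    have "\<forall>\<^sub>F k in sequentially. \<tau> k \<ge> \<tau> n + t" using \<tau>(1) filterlim_at_top by blast
    then show "\<forall>\<^sub>F k in sequentially. h (z (\<tau> k + s)) \<le> h (z (\<tau> n + t))"
      by eventually_elim (use \<tau>(2)[of n] s t in \<open>intro mono; simp\<close>)
  qed simp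
  then show "h (w s) \<le> h (w t)"
    using s t by (intro tendsto_lowerbound[OF hl[of t]]) auto
qed

section \<open>Quadratic forms\<close>

lemma continuous_on_matrix_vector_mult:
  fixes M :: "'a::topological_space \<Rightarrow> real^'n^'m" and v :: "'a \<Rightarrow> real^'n"
  assumes "continuous_on S M" "continuous_on S v"
  shows "continuous_on S (\<lambda>x. M x *v v x)"
  unfolding matrix_vector_mult_def using assms by (intro continuous_intros) auto

text \<open>\<open>m\<close> is the minimum of the form on the unit sphere; homogeneity of degree
  two does the rest.\<close>

lemma positive_definite_coercive:
  fixes P :: "real^'n^'n"
  assumes "positive_definite P"
  shows "\<exists>m>0. \<forall>x. m * (norm x)\<^sup>2 \<le> x \<bullet> (P *v x)"
proof -
  have "compact (sphere (0::real^'n) 1)" "sphere (0::real^'n) 1 \<noteq> {}" by auto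
  moreover have "continuous_on (sphere 0 1) (\<lambda>x. x \<bullet> (P *v x))"
    by (intro continuous_intros)
  ultimately obtain u where u: "norm u = 1" "\<And>x. norm x = 1 \<Longrightarrow> u \<bullet> (P *v u) \<le> x \<bullet> (P *v x)"
    using continuous_attains_inf by (metis mem_sphere_0)
  have "u \<noteq> 0" using u(1) by auto
  then have "u \<bullet> (P *v u) > 0" using assms unfolding positive_definite_def by blast
  moreover have "u \<bullet> (P *v u) * (norm x)\<^sup>2 \<le> x \<bullet> (P *v x)" for x
  proof (cases "x = 0")
    case False
    define y where "y = (1 / norm x) *\<^sub>R x"
    have x: "x = norm x *\<^sub>R y" "norm y = 1" using False unfolding y_def by auto
    have "x \<bullet> (P *v x) = (norm x)\<^sup>2 * (y \<bullet> (P *v y))"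
      by (subst x(1), subst (2) x(1)) (simp add: matrix_vector_mult_scaleR power2_eq_square)
    then show ?thesis using u(2)[OF x(2)] by (simp add: mult.commute mult_right_mono)
  qed simp
  ultimately show ?thesis by blast
qed

text \<open>With lower bound \<open>m\<close> for the form and \<open>K\<close> for the map
  \<open>P\<close>, the constant is \<open>sqrt (K / m)\<close>. It converts decay of the error
  energy into Euclidean bounds.\<close>

lemma positive_definite_norm_compare:
  fixes P :: "real^'n^'n"
  assumes "positive_definite P"
  shows "\<exists>\<kappa>>0. \<forall>u v. v \<bullet> (P *v v) \<le> u \<bullet> (P *v u) \<longrightarrow> norm v \<le> \<kappa> * norm u"
proof -
  obtain m where m: "m > 0" "\<And>x. m * (norm x)\<^sup>2 \<le> x \<bullet> (P *v x)"
    using positive_definite_coercive[OF assms] by blast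
  obtain K where K: "K > 0" "\<And>x. norm (P *v x) \<le> norm x * K"
    using bounded_linear.pos_bounded[OF matrix_vector_mul_bounded_linear[of P]] by blast
  have "norm v \<le> sqrt (K / m) * norm u" if "v \<bullet> (P *v v) \<le> u \<bullet> (P *v u)" for u v
  proof -
    have "m * (norm v)\<^sup>2 \<le> u \<bullet> (P *v u)" using m(2)[of v] that by simp
    also have "\<dots> \<le> norm u * norm (P *v u)" by (rule norm_cauchy_schwarz)
    also have "\<dots> \<le> norm u * (norm u * K)" by (intro mult_left_mono K) auto
    finally have "(norm v)\<^sup>2 \<le> (K / m) * (norm u)\<^sup>2"
      using m(1) by (simp add: field_simps power2_eq_square)
    then have "sqrt ((norm v)\<^sup>2) \<le> sqrt ((K / m) * (norm u)\<^sup>2)" by (rule real_sqrt_le_mono)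
    then show ?thesis by (simp only: real_sqrt_mult real_sqrt_abs abs_norm_cancel)
  qed
  then show ?thesis using m(1) K(1) by (intro exI[of _ "sqrt (K / m)"]) auto
qed

lemma positive_definite_matrix_inv:
  fixes P :: "real^'n^'n"
  assumes "positive_definite P"
  shows "P ** matrix_inv P = mat 1"
proof -
  have "x = 0" if "P *v x = 0" for x
  proof (rule ccontr)
    assume "x \<noteq> 0"
    then have "x \<bullet> (P *v x) > 0" using assms unfolding positive_definite_def by blast
    then show False using that by simp
  qed
  then have "\<exists>B. B ** P = mat 1" by (simp add: matrix_left_invertible_ker)
  then have "invertible P" by (simp add: invertible_left_inverse)
  then show ?thesis unfolding invertible_def matrix_inv_def by (metis (mono_tags, lifting) someI_ex)
qed

lemma has_vector_derivative_quadratic_form: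
  fixes P :: "real^'n^'n"
  assumes "transpose P = P" "(x has_vector_derivative v) (at t within S)"
  shows "((\<lambda>t. x t \<bullet> (P *v x t)) has_vector_derivative 2 * (x t \<bullet> (P *v v))) (at t within S)"
proof -
  have "((\<lambda>t. P *v x t) has_vector_derivative P *v v) (at t within S)"
    by (rule bounded_linear.has_vector_derivative[OF matrix_vector_mul_bounded_linear assms(2)])
  with assms(2) have "((\<lambda>t. x t \<bullet> (P *v x t)) has_vector_derivative x t \<bullet> (P *v v) + v \<bullet> (P *v x t)) (at t within S)"
    by (intro bounded_bilinear.has_vector_derivative[OF bounded_bilinear_inner])
  moreover have "v \<bullet> (P *v x t) = x t \<bullet> (P *v v)"
    by (metis assms(1) dot_lmul_matrix inner_commute vector_transpose_matrix)
  ultimately show ?thesis by simp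
qed

section \<open>Linear time-varying equations started at zero\<close>

text \<open>With \<open>c\<close> bounding the forms of \<open>M t\<close> on the unit sphere over
  \<open>{0..T}\<close>, the squared norm grows at rate at most \<open>2 * c\<close>. This makes
  zero error invariant for the coupled system.\<close>

lemma gronwall_zero:
  fixes M :: "real \<Rightarrow> real^'n^'n"
  assumes M: "continuous_on {0..} M" and x0: "x 0 = 0"
    and x: "\<And>t. t \<ge> 0 \<Longrightarrow> (x has_vector_derivative M t *v x t) (at t within {0..})" and T: "0 \<le> T"
  shows "x T = 0"
proof -
  have "continuous_on ({0..T} \<times> sphere 0 1) (\<lambda>(t, v). v \<bullet> (M t *v v))"
    unfolding case_prod_beta
    by (intro continuous_intros continuous_on_matrix_vector_mult
        continuous_on_compose2[OF M continuous_on_fst]) auto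
  then have "compact ((\<lambda>(t, v). v \<bullet> (M t *v v)) ` ({0..T} \<times> sphere 0 1))"
    by (intro compact_continuous_image compact_Times) auto
  then have "bounded ((\<lambda>(t, v). v \<bullet> (M t *v v)) ` ({0..T} \<times> sphere 0 1))"
    by (rule compact_imp_bounded)
  then obtain c where c: "\<forall>q\<in>(\<lambda>(t, v). v \<bullet> (M t *v v)) ` ({0..T} \<times> sphere 0 1). norm q \<le> c"
    unfolding bounded_iff by blast
  have c': "v \<bullet> (M t *v v) \<le> c * (v \<bullet> v)" if "t \<in> {0..T}" for t v
  proof (cases "v = 0")
    case False
    define y where "y = (1 / norm v) *\<^sub>R v"
    have v: "v = norm v *\<^sub>R y" "norm y = 1" using False unfolding y_def by auto
    have "norm (y \<bullet> (M t *v y)) \<le> c"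
      by (rule bspec[OF c]) (use that v(2) in \<open>auto intro!: image_eqI[of _ _ "(t, y)"]\<close>)
    moreover have "v \<bullet> (M t *v v) = (norm v)\<^sup>2 * (y \<bullet> (M t *v y))"
      by (subst v(1), subst (2) v(1)) (simp add: matrix_vector_mult_scaleR power2_eq_square)
    ultimately show ?thesis
      using mult_right_mono[of "y \<bullet> (M t *v y)" c "(norm v)\<^sup>2"]
      by (simp add: dot_square_norm mult.commute)
  qed simp
  \<comment> \<open>The weight cancels the growth rate, so \<open>h\<close> is nonincreasing and
    starts at 0.\<close>
  define h where "h t = exp (- (2 * c) * t) * (x t \<bullet> x t)" for t
  have hd: "(h has_vector_derivative exp (- (2 * c) * t) * (2 * (x t \<bullet> (M t *v x t)) - 2 * c * (x t \<bullet> x t)))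
      (at t within {0..})" if "t \<ge> 0" for t
  proof -
    have "((\<lambda>t. exp (- (2 * c) * t)) has_vector_derivative - (2 * c) * exp (- (2 * c) * t)) (at t within {0..})"
      unfolding has_real_derivative_iff_has_vector_derivative[symmetric]
      by (auto intro!: derivative_eq_intros)
    moreover have "((\<lambda>t. x t \<bullet> x t) has_vector_derivative x t \<bullet> (M t *v x t) + (M t *v x t) \<bullet> x t) (at t within {0..})"
      by (intro bounded_bilinear.has_vector_derivative[OF bounded_bilinear_inner] x that)
    ultimately have "(h has_vector_derivative exp (- (2 * c) * t) * (x t \<bullet> (M t *v x t) + (M t *v x t) \<bullet> x t)
        + (- (2 * c) * exp (- (2 * c) * t)) * (x t \<bullet> x t)) (at t within {0..})"
      unfolding h_def by (intro bounded_bilinear.has_vector_derivative[OF bounded_bilinear_mult])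
    then show ?thesis by (simp add: inner_commute algebra_simps)
  qed
  have "h T \<le> h 0"
  proof (rule DERIV_nonpos_imp_decreasing_open[OF T])
    show "continuous_on {0..T} h"
      unfolding continuous_on_eq_continuous_within
      using hd has_vector_derivative_continuous has_vector_derivative_within_subset
      by (metis atLeastAtMost_iff atLeast_iff subsetI)
    fix t assume t: "0 < t" "t < T"
    have "(h has_vector_derivative exp (- (2 * c) * t) * (2 * (x t \<bullet> (M t *v x t)) - 2 * c * (x t \<bullet> x t))) (at t)"
      using hd[of t] t by (simp only: at_within_atLeast)
    moreover have "exp (- (2 * c) * t) * (2 * (x t \<bullet> (M t *v x t)) - 2 * c * (x t \<bullet> x t)) \<le> 0"
      using c'[of t "x t"] t by (intro mult_nonneg_nonpos) auto
    ultimately show "\<exists>y. DERIV h t :> y \<and> y \<le> 0"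
      unfolding has_real_derivative_iff_has_vector_derivative by blast
  qed
  then have "exp (- (2 * c) * T) * (x T \<bullet> x T) \<le> 0" unfolding h_def using x0 by simp
  then have "x T \<bullet> x T \<le> 0" by (simp add: mult_le_0_iff)
  then show ?thesis by (metis inner_eq_zero_iff inner_ge_zero order_antisym)
qed

section \<open>The observer system\<close>

locale observer_problem =
  fixes A :: "real^'m \<Rightarrow> real^'n^'n"
    and B :: "real^'m \<Rightarrow> real^'n"
    and C :: "real^'n^'p"
    and l :: "real^'n \<Rightarrow> real^'m"
    and P :: "real^'n^'n"
  assumes contA: "continuous_on UNIV A" and contB: "continuous_on UNIV B"
    and contl: "continuous_on UNIV l" and l0: "l 0 = 0"
    and well_posed: "\<And>\<alpha> xh0 e0. \<alpha> > 0 \<Longrightarrow>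
          unique_global_solution (observer_system A B C l \<alpha> P) (xh0, e0)"
    and stable: "asymptotically_stable (feedback_field A B l) 0"
    and openD: "open (basin_of_attraction (feedback_field A B l) 0)"
    and pd: "positive_definite P"
    and dissipative: "\<And>x xh. xh \<in> basin_of_attraction (feedback_field A B l) 0 \<Longrightarrow>
          x \<bullet> ((P ** A (l xh)) *v x) \<le> 0"
    and detectable: "detectable C (A 0)"
begin

abbreviation "f \<equiv> feedback_field A B l"
abbreviation "F \<equiv> \<lambda>\<alpha>. observer_system A B C l \<alpha> P"
abbreviation "D \<equiv> basin_of_attraction f 0"

text \<open>Output injection per unit of \<open>\<alpha>\<close>, separated so that the factor
  \<open>\<alpha>\<close> stays explicit in smallness estimates.\<close>

definition gain :: "real^'n^'n" where "gain = matrix_inv P ** transpose C ** C"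
definition energy :: "real^'n \<Rightarrow> real" where "energy v = v \<bullet> (P *v v)"

section \<open>Continuity and well-posedness of the two vector fields\<close>

lemma contAl: "continuous_on S (\<lambda>x. A (l x))"
  by (rule continuous_on_compose2[OF contA continuous_on_subset[OF contl]]) auto

lemma contBl: "continuous_on S (\<lambda>x. B (l x))"
  by (rule continuous_on_compose2[OF contB continuous_on_subset[OF contl]]) auto

lemma continuous_field: "continuous_on S f"
  unfolding feedback_field_def
  by (intro continuous_intros continuous_on_matrix_vector_mult contAl contBl)

lemma F_eq: "F \<alpha> (x, e) = (f x - \<alpha> *\<^sub>R (gain *v e), A (l x) *v e - \<alpha> *\<^sub>R (gain *v e))"
  unfolding observer_system_def feedback_field_def gain_def
  by (simp add: matrix_vector_mult_diff_rdistrib scaleR_matrix_vector_assoc)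

lemma F_eq': "F \<alpha> = (\<lambda>z. (f (fst z) - \<alpha> *\<^sub>R (gain *v snd z),
                     A (l (fst z)) *v snd z - \<alpha> *\<^sub>R (gain *v snd z)))"
  by (rule ext) (metis F_eq prod.collapse)

lemma continuous_F: "continuous_on UNIV (F \<alpha>)"
  unfolding F_eq'
  by (intro continuous_intros continuous_on_matrix_vector_mult
      continuous_on_compose2[OF continuous_field[of UNIV]] continuous_on_compose2[OF contAl[of UNIV]]) auto

lemma F_solution_fst:
  "solution_on (F \<alpha>) z J \<Longrightarrow> t \<in> J \<Longrightarrow>
     ((\<lambda>t. fst (z t)) has_vector_derivative f (fst (z t)) - \<alpha> *\<^sub>R (gain *v snd (z t))) (at t within J)"
  using bounded_linear.has_vector_derivative[OF bounded_linear_fst solution_on_D] F_eq' by fastforce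

lemma F_solution_snd:
  "solution_on (F \<alpha>) z J \<Longrightarrow> t \<in> J \<Longrightarrow>
     ((\<lambda>t. snd (z t)) has_vector_derivative A (l (fst (z t))) *v snd (z t) - \<alpha> *\<^sub>R (gain *v snd (z t)))
       (at t within J)"
  using bounded_linear.has_vector_derivative[OF bounded_linear_snd solution_on_D] F_eq' by fastforce

lemma unique_global_F: "\<alpha> > 0 \<Longrightarrow> unique_global_flow (F \<alpha>)"
  by unfold_locales (auto simp: continuous_F intro: well_posed)

text \<open>Well-posedness is assumed for the coupled system only. The subspace of zero error is
  invariant, and there the first component follows \<open>f\<close>; conversely each solution
  \<open>y\<close> of the feedback equation yields the coupled solution
  \<open>(y, 0)\<close>.\<close>

lemma unique_global_f: "unique_global_flow f"
proof
  show "continuous_on UNIV f" by (rule continuous_field)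
  fix x0
  \<comment> \<open>Any positive gain would serve, because the injected term vanishes at zero
    error.\<close>
  interpret F: unique_global_flow "F 1" by (rule unique_global_F) simp
  obtain z where z: "solution_on (F 1) z {0..}" "z 0 = (x0, 0)" by (rule F.solution_exists)
  have zc: "continuous_on {0..} z" by (rule solution_on_continuous[OF z(1)])
  have z0: "snd (z t) = 0" if "t \<ge> 0" for t
  proof (rule gronwall_zero[where M = "\<lambda>t. A (l (fst (z t))) - gain"])
    show "continuous_on {0..} (\<lambda>t. A (l (fst (z t))) - gain)"
      by (rule continuous_on_diff[OF continuous_on_compose2[OF contAl[of UNIV] continuous_on_fst[OF zc]]]) auto
    show "((\<lambda>t. snd (z t)) has_vector_derivative (A (l (fst (z t))) - gain) *v snd (z t)) (at t within {0..})"
      if "t \<ge> 0" for t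
      using F_solution_snd[OF z(1), of t] that by (simp add: matrix_vector_mult_diff_rdistrib)
  qed (use z that in auto)
  have "solution_on f (\<lambda>t. fst (z t)) {0..}"
    unfolding solution_on_def
  proof (intro conjI ballI)
    show "((\<lambda>t. fst (z t)) has_vector_derivative f (fst (z t))) (at t within {0..})"
      if "t \<in> {0..}" for t
      using F_solution_fst[OF z(1) that] z0[of t] that by simp
  qed (auto simp: is_interval_ci)
  moreover have "fst (z 0) = x0" using z(2) by simp
  moreover have "y t = fst (z t)" if y: "solution_on f y {0..}" "y 0 = x0" and t: "t \<ge> 0" for y t
  proof -
    have "solution_on (F 1) (\<lambda>t. (y t, 0)) {0..}"
      unfolding solution_on_def
    proof (intro conjI ballI)
      fix s :: real assume "s \<in> {0..}"
      then have "((\<lambda>t. (y t, 0)) has_vector_derivative (f (y s), 0)) (at s within {0..})"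
        by (intro has_vector_derivative_Pair solution_on_D[OF y(1)] has_vector_derivative_const)
      then show "((\<lambda>t. (y t, 0)) has_vector_derivative F 1 (y s, 0)) (at s within {0..})"
        by (simp add: F_eq)
    qed (auto simp: is_interval_ci)
    then have "(y t, 0) = z t"
      by (rule F.solution_unique[OF _ z(1) _ t]) (use y(2) z(2) in simp)
    then show ?thesis by (metis fst_conv)
  qed
  ultimately show "unique_global_solution f x0"
    unfolding unique_global_solution_def by blast
qed

sublocale f: unique_global_flow "feedback_field A B l" by (rule unique_global_f)

section \<open>Dissipation of the error energy and confinement of the estimate\<close>

lemma P_gain: "P ** gain = transpose C ** C"
  unfolding gain_def
  by (simp add: matrix_mul_assoc positive_definite_matrix_inv[OF pd])

text \<open>Multiplying the gain by \<open>P\<close> leaves \<open>transpose C ** C\<close>, so the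
  injection contributes exactly minus \<open>\<alpha>\<close> times the squared output
  error.\<close>

lemma energy_derivative:
  assumes z: "solution_on (F \<alpha>) z J" and t: "t \<in> J"
  shows "((\<lambda>t. energy (snd (z t))) has_vector_derivative
     2 * (snd (z t) \<bullet> ((P ** A (l (fst (z t)))) *v snd (z t)) - \<alpha> * (norm (C *v snd (z t)))\<^sup>2)) (at t within J)"
proof -
  have "(P *v (gain *v v)) = transpose C *v (C *v v)" for v
    by (simp only: matrix_vector_mul_assoc P_gain)
  moreover have "v \<bullet> (transpose C *v (C *v v)) = (norm (C *v v))\<^sup>2" for v
    by (metis dot_lmul_matrix inner_commute power2_norm_eq_inner transpose_matrix_vector)
  ultimately have "v \<bullet> (P *v (A (l x) *v v - \<alpha> *\<^sub>R (gain *v v))) =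
      v \<bullet> ((P ** A (l x)) *v v) - \<alpha> * (norm (C *v v))\<^sup>2" for v x
    by (simp add: matrix_vector_mult_diff_distrib matrix_vector_mult_scaleR inner_diff_right
        flip: matrix_vector_mul_assoc)
  then show ?thesis
    using has_vector_derivative_quadratic_form[OF _ F_solution_snd[OF z t], of P] pd
    unfolding energy_def positive_definite_def by simp
qed

lemma continuous_energy: "continuous_on S energy"
  unfolding energy_def by (intro continuous_intros continuous_on_matrix_vector_mult)

text \<open>Membership in \<open>D\<close> is asked on the half-open interval only: derivatives
  matter in the interior and continuity reaches \<open>t\<close>. This allows use up to a first exit
  time, where the estimate is outside \<open>D\<close>.\<close>

lemma energy_antimono:
  assumes \<alpha>: "\<alpha> > 0" and z: "solution_on (F \<alpha>) z {0..}" and s: "0 \<le> s" "s \<le> t"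
    and inD: "\<And>r. s \<le> r \<Longrightarrow> r < t \<Longrightarrow> fst (z r) \<in> D"
  shows "energy (snd (z t)) \<le> energy (snd (z s))"
proof (rule DERIV_nonpos_imp_decreasing_open[OF s(2)])
  have "continuous_on {s..t} z"
    by (rule continuous_on_subset[OF solution_on_continuous[OF z]]) (use s in auto)
  then show "continuous_on {s..t} (\<lambda>t. energy (snd (z t)))"
    by (intro continuous_on_compose2[OF continuous_energy[of UNIV]] continuous_intros) auto
  fix r assume r: "s < r" "r < t"
  let ?v = "snd (z r)"
  have "((\<lambda>t. energy (snd (z t))) has_vector_derivative
     2 * (?v \<bullet> ((P ** A (l (fst (z r)))) *v ?v) - \<alpha> * (norm (C *v ?v))\<^sup>2)) (at r within {0..})"
    by (rule energy_derivative[OF z]) (use r s in auto)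
  then have "((\<lambda>t. energy (snd (z t))) has_vector_derivative
     2 * (?v \<bullet> ((P ** A (l (fst (z r)))) *v ?v) - \<alpha> * (norm (C *v ?v))\<^sup>2)) (at r)"
    using at_within_atLeast[of 0 r] r s by simp
  moreover have "2 * (?v \<bullet> ((P ** A (l (fst (z r)))) *v ?v) - \<alpha> * (norm (C *v ?v))\<^sup>2) \<le> 0"
  proof -
    have 1: "?v \<bullet> ((P ** A (l (fst (z r)))) *v ?v) \<le> 0" using inD r by (intro dissipative) auto
    have 2: "0 \<le> \<alpha> * (norm (C *v ?v))\<^sup>2" using \<alpha> by simp
    from order_trans[OF 1 2] show ?thesis by (intro mult_nonneg_nonpos) simp_all
  qed
  ultimately show "\<exists>y. DERIV (\<lambda>t. energy (snd (z t))) r :> y \<and> y \<le> 0"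
    unfolding has_real_derivative_iff_has_vector_derivative by blast
qed

text \<open>Bootstrap: while the estimate is in \<open>D\<close> the energy does not grow, so the
  injected term is at most \<open>\<delta>\<close>, so the estimate is a perturbed solution and lies
  in \<open>L\<close>, hence in \<open>D\<close>.\<close>

lemma observer_confined:
  assumes \<alpha>: "\<alpha> > 0" and z: "solution_on (F \<alpha>) z {0..}"
    and L: "\<And>T. perturbed_solution f \<delta> (\<lambda>t. fst (z t)) T \<Longrightarrow> \<forall>t\<in>{0..T}. fst (z t) \<in> L" "L \<subseteq> D"
    and small: "\<And>v. energy v \<le> energy (snd (z 0)) \<Longrightarrow> \<alpha> * norm (gain *v v) \<le> \<delta>"
    and t: "0 \<le> t"
  shows "fst (z t) \<in> L" "energy (snd (z t)) \<le> energy (snd (z 0))"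
proof -
  have step: "fst (z t) \<in> L" if t: "0 \<le> t" and inD: "\<And>s. 0 \<le> s \<Longrightarrow> s < t \<Longrightarrow> fst (z s) \<in> D" for t
  proof -
    have "perturbed_solution f \<delta> (\<lambda>t. fst (z t)) t"
      unfolding perturbed_solution_def
    proof
      fix s assume s: "s \<in> {0..t}"
      have "energy (snd (z s)) \<le> energy (snd (z 0))"
        by (rule energy_antimono[OF \<alpha> z]) (use s inD in auto)
      then have "\<alpha> * norm (gain *v snd (z s)) \<le> \<delta>" by (rule small)
      moreover have "((\<lambda>t. fst (z t)) has_vector_derivative f (fst (z s)) - \<alpha> *\<^sub>R (gain *v snd (z s)))
          (at s within {0..t})"
        by (rule has_vector_derivative_within_subset[OF F_solution_fst[OF z]]) (use s in auto)
      ultimately show "\<exists>v. ((\<lambda>t. fst (z t)) has_vector_derivative v) (at s within {0..t}) \<and>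
          norm (v - f (fst (z s))) \<le> \<delta>"
        using \<alpha> by (intro exI[of _ "f (fst (z s)) - \<alpha> *\<^sub>R (gain *v snd (z s))"]) auto
    qed
    then show ?thesis using L(1) t by auto
  qed
  have xc: "continuous_on {0..} (\<lambda>t. fst (z t))"
    by (intro continuous_intros solution_on_continuous[OF z])
  have all: "fst (z t) \<in> D" if "0 \<le> t" for t
  proof (rule ccontr)
    assume bad: "fst (z t) \<notin> D"
    \<comment> \<open>\<open>D\<close> is open, so the exit times form a compact set and the first
      one \<open>s\<close> is attained; before \<open>s\<close> the estimate is in \<open>D\<close>,
      which puts it in \<open>L\<close> at \<open>s\<close>.\<close>
    define E where "E = {0..t} \<inter> (\<lambda>t. fst (z t)) -` (- D)"
    have "closed E" unfolding E_def using openD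
      by (intro continuous_closed_preimage continuous_on_subset[OF xc]) (auto simp: closed_Compl)
    moreover have "E = {0..t} \<inter> E" unfolding E_def by auto
    ultimately have "compact E" by (metis compact_Int_closed compact_Icc)
    moreover have "t \<in> E" using bad that unfolding E_def by auto
    ultimately obtain s where s: "s \<in> E" "\<And>r. r \<in> E \<Longrightarrow> s \<le> r"
      using compact_attains_inf by (metis empty_iff)
    have "fst (z s) \<in> L"
    proof (rule step)
      show "0 \<le> s" using s(1) unfolding E_def by auto
      show "fst (z r) \<in> D" if "0 \<le> r" "r < s" for r
        using s(2)[of r] that s(1) unfolding E_def by force
    qed
    then show False using L(2) s(1) unfolding E_def by auto
  qed
  show "fst (z t) \<in> L" by (rule step) (use all t in auto)
  show "energy (snd (z t)) \<le> energy (snd (z 0))" by (rule energy_antimono[OF \<alpha> z]) (use all t in auto)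
qed


section \<open>Invariance principle for the coupled system\<close>

text \<open>Constant energy has zero derivative, and both contributions to that derivative are
  nonpositive, so each must vanish.\<close>

lemma energy_stationary_imp_output_zero:
  assumes \<alpha>: "\<alpha> > 0" and w: "solution_on (F \<alpha>) w {0..}"
    and inD: "\<And>t. t \<ge> 0 \<Longrightarrow> fst (w t) \<in> D"
    and const: "\<And>t. t \<ge> 0 \<Longrightarrow> energy (snd (w t)) = energy (snd (w 0))" and t: "0 \<le> t"
  shows "C *v snd (w t) = 0"
proof -
  let ?v = "snd (w t)"
  let ?d = "2 * (?v \<bullet> ((P ** A (l (fst (w t)))) *v ?v) - \<alpha> * (norm (C *v ?v))\<^sup>2)"
  have "((\<lambda>t. energy (snd (w t))) has_vector_derivative ?d) (at t within {0..})"
    by (rule energy_derivative[OF w]) (use t in simp)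
  then have "((\<lambda>t. energy (snd (w 0))) has_vector_derivative ?d) (at t within {0..})"
  proof (rule has_vector_derivative_transform[rotated 2])
    show "energy (snd (w 0)) = energy (snd (w s))" if "s \<in> {0..}" for s
      using that by (intro const[symmetric]) simp
  qed (use t in simp)
  \<comment> \<open>Right derivatives are unique at every \<open>t\<close>, including
    \<open>t = 0\<close>.\<close>
  then have "((\<lambda>t. energy (snd (w 0))) has_vector_derivative ?d) (at t within {t<..})"
    by (rule has_vector_derivative_within_subset) (use t in auto)
  then have "?d = 0"
    by (rule vector_derivative_unique_within[rotated, OF _ has_vector_derivative_const])
      (rule trivial_limit_at_right_real)
  moreover have "?v \<bullet> ((P ** A (l (fst (w t)))) *v ?v) \<le> 0"
    by (rule dissipative[OF inD[OF t]])
  ultimately have "\<alpha> * (norm (C *v ?v))\<^sup>2 \<le> 0" by simp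
  then show ?thesis using \<alpha> by (simp add: mult_le_0_iff)
qed

lemma gain_eq_0: "C *v v = 0 \<Longrightarrow> gain *v v = 0"
  unfolding gain_def by (metis matrix_vector_mul_assoc matrix_vector_mult_0_right)

text \<open>Two successive omega-limits: on \<open>w\<close> the output error is zero and the
  estimate tends to 0; on \<open>y\<close>, a limit of \<open>w\<close>, the estimate is 0 and
  detectability sends the error to 0.\<close>

lemma observer_recurrent:
  assumes \<alpha>: "\<alpha> > 0" and z: "solution_on (F \<alpha>) z {0..}"
    and L: "compact L" "L \<subseteq> D" "\<And>t. t \<ge> 0 \<Longrightarrow> fst (z t) \<in> L" and r: "r > 0"
  shows "\<exists>t\<ge>0. norm (z t) < r"
proof -
  interpret F: unique_global_flow "F \<alpha>" by (rule unique_global_F[OF \<alpha>])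
  obtain \<kappa> where \<kappa>: "\<kappa> > 0" "\<And>u v. energy v \<le> energy u \<Longrightarrow> norm v \<le> \<kappa> * norm u"
    using positive_definite_norm_compare[OF pd] unfolding energy_def by blast
  have zdec: "energy (snd (z t)) \<le> energy (snd (z s))" if "0 \<le> s" "s \<le> t" for s t
    by (rule energy_antimono[OF \<alpha> z that]) (use that L in auto)
  \<comment> \<open>A compact set holding the whole trajectory; being closed, it also holds the
    limit \<open>w\<close>.\<close>
  define Z where "Z = L \<times> cball (0::real^'n) (\<kappa> * norm (snd (z 0)))"
  have Z: "compact Z" unfolding Z_def using L by (intro compact_Times) auto
  then have Zb: "bounded Z" and Zc: "closed Z" by (auto intro: compact_imp_bounded compact_imp_closed)
  have zZ: "z t \<in> Z" if "t \<ge> 0" for t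
    using L(3)[OF that] \<kappa>(2)[OF zdec[of 0 t]] that unfolding Z_def by (simp add: mem_Times_iff)
  have bz: "bounded (z ` {0..})"
    by (rule bounded_subset[OF Zb]) (use zZ in auto)
  obtain w \<tau> where w: "solution_on (F \<alpha>) w {0..}" "filterlim \<tau> at_top sequentially"
    "\<And>n. \<tau> n \<ge> 0" "\<And>t. t \<ge> 0 \<Longrightarrow> (\<lambda>n. z (\<tau> n + t)) \<longlonglongrightarrow> w t"
    by (rule F.omega_limit_solution[OF z bz]) (rule that; assumption)
  have wZ: "w t \<in> Z" if "t \<ge> 0" for t
    by (rule closed_sequentially[OF Zc _ w(4)[OF that]]) (use zZ w(3) that in auto)
  have wL: "fst (w t) \<in> D" if "t \<ge> 0" for t
    using wZ[OF that] L(2) unfolding Z_def by (auto simp: mem_Times_iff)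
  have wconst: "energy (snd (w t)) = energy (snd (w 0))" if "t \<ge> 0" for t
    by (rule omega_limit_constant[OF w(4) w(2,3), where h = "\<lambda>z. energy (snd z)"])
      (use that zdec in \<open>auto intro!: continuous_on_compose2[OF continuous_energy[of UNIV]] continuous_on_snd continuous_on_id\<close>)
  have Cw: "C *v snd (w t) = 0" if "t \<ge> 0" for t
    by (rule energy_stationary_imp_output_zero[OF \<alpha> w(1) wL wconst that])
  have "solution_on f (\<lambda>t. fst (w t)) {0..}"
    unfolding solution_on_def
  proof (intro conjI ballI)
    show "((\<lambda>t. fst (w t)) has_vector_derivative f (fst (w t))) (at t within {0..})"
      if "t \<in> {0..}" for t
      using F_solution_fst[OF w(1) that] gain_eq_0[OF Cw[of t]] that by simp
  qed (auto simp: is_interval_ci)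
  then have w1: "((\<lambda>t. fst (w t)) \<longlongrightarrow> 0) at_top"
    using wL[of 0] unfolding f.basin_of_attraction_eq by auto
  have bw: "bounded (w ` {0..})"
    by (rule bounded_subset[OF Zb]) (use wZ in auto)
  obtain y \<sigma> where y: "solution_on (F \<alpha>) y {0..}" "filterlim \<sigma> at_top sequentially"
    "\<And>n. \<sigma> n \<ge> 0" "\<And>t. t \<ge> 0 \<Longrightarrow> (\<lambda>n. w (\<sigma> n + t)) \<longlonglongrightarrow> y t"
    by (rule F.omega_limit_solution[OF w(1) bw]) (rule that; assumption)
  have y1: "fst (y t) = 0" if "t \<ge> 0" for t
  proof (rule LIMSEQ_unique[OF tendsto_fst[OF y(4)[OF that]]])
    have "filterlim (\<lambda>n. \<sigma> n + t) at_top sequentially"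
      using filterlim_tendsto_add_at_top[OF tendsto_const y(2), of t] by (simp only: add.commute)
    from filterlim_compose[OF w1 this] show "(\<lambda>n. fst (w (\<sigma> n + t))) \<longlonglongrightarrow> 0" .
  qed
  have Cy: "C *v snd (y t) = 0" if "t \<ge> 0" for t
  proof -
    have "(\<lambda>n. C *v snd (w (\<sigma> n + t))) \<longlonglongrightarrow> C *v snd (y t)"
      by (rule bounded_linear.tendsto[OF matrix_vector_mul_bounded_linear tendsto_snd[OF y(4)[OF that]]])
    moreover have "C *v snd (w (\<sigma> n + t)) = 0" for n using Cw[of "\<sigma> n + t"] y(3)[of n] that by simp
    ultimately show ?thesis by (simp add: LIMSEQ_const_iff)
  qed
  have "solution_on (\<lambda>v. A 0 *v v) (\<lambda>t. snd (y t)) {0..}"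
    unfolding solution_on_def
  proof (intro conjI ballI)
    show "((\<lambda>t. snd (y t)) has_vector_derivative A 0 *v snd (y t)) (at t within {0..})"
      if "t \<in> {0..}" for t
      using F_solution_snd[OF y(1) that] gain_eq_0[OF Cy[of t]] y1[of t] l0 that by simp
  qed (auto simp: is_interval_ci)
  then have y2: "((\<lambda>t. snd (y t)) \<longlongrightarrow> 0) at_top"
    using detectable Cy unfolding detectable_def by blast
  have "\<forall>\<^sub>F t in at_top. t \<ge> (0::real) \<and> norm (snd (y t)) < r"
    using eventually_conj[OF eventually_ge_at_top[of 0] tendstoD[OF y2 r]] by simp
  \<comment> \<open>Closeness to the origin is now passed back, from \<open>y\<close> to a later
    time of \<open>w\<close> and from there to a later time of \<open>z\<close>.\<close>
  then obtain t where t: "t \<ge> 0" "norm (snd (y t)) < r"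
    by (metis (no_types, lifting) eventually_happens' trivial_limit_at_top_linorder)
  then have "norm (y t) < r" using y1[OF t(1)] by (simp add: norm_Pair norm_prod_def)
  then have "\<forall>\<^sub>F n in sequentially. norm (w (\<sigma> n + t)) < r"
    using order_tendstoD(2)[OF tendsto_norm[OF y(4)[OF t(1)]]] by blast
  then obtain n where n: "norm (w (\<sigma> n + t)) < r"
    by (metis (no_types, lifting) eventually_happens' sequentially_bot)
  have nt: "0 \<le> \<sigma> n + t" using y(3)[of n] t(1) by simp
  have "\<forall>\<^sub>F k in sequentially. norm (z (\<tau> k + (\<sigma> n + t))) < r"
    using order_tendstoD(2)[OF tendsto_norm[OF w(4)[OF nt]] n] .
  then obtain k where k: "norm (z (\<tau> k + (\<sigma> n + t))) < r"
    by (metis (no_types, lifting) eventually_happens' sequentially_bot)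
  then show ?thesis using w(3)[of k] nt by (intro exI[of _ "\<tau> k + (\<sigma> n + t)"]) auto
qed

section \<open>Stability and attraction of the origin\<close>

lemma gain_bound:
  obtains g where "g > 0" "\<And>u v. energy v \<le> energy u \<Longrightarrow> norm (gain *v v) \<le> g * norm u"
proof -
  obtain \<kappa> where \<kappa>: "\<kappa> > 0" "\<And>u v. energy v \<le> energy u \<Longrightarrow> norm v \<le> \<kappa> * norm u"
    using positive_definite_norm_compare[OF pd] unfolding energy_def by blast
  obtain K where K: "K > 0" "\<And>x. norm (gain *v x) \<le> norm x * K"
    using bounded_linear.pos_bounded[OF matrix_vector_mul_bounded_linear[of gain]] by blast
  show thesis
  proof
    show "K * \<kappa> > 0" using K \<kappa> by simp
    fix u v :: "real^'n" assume "energy v \<le> energy u"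
    have "norm (gain *v v) \<le> norm v * K" by (rule K(2))
    also have "\<dots> \<le> (\<kappa> * norm u) * K"
      using \<kappa>(2)[OF \<open>energy v \<le> energy u\<close>] K(1) by (intro mult_right_mono) auto
    finally show "norm (gain *v v) \<le> K * \<kappa> * norm u" by (simp add: mult.commute mult.left_commute)
  qed
qed

text \<open>Here \<open>\<alpha>\<close> is fixed, and the injected term is made small through the
  initial error, whose energy cannot increase; total stability of \<open>f\<close> then controls the
  estimate.\<close>

lemma observer_lyapunov_stable:
  assumes \<alpha>: "\<alpha> > 0"
  shows "lyapunov_stable (F \<alpha>) (0, 0)"
proof -
  interpret F: unique_global_flow "F \<alpha>" by (rule unique_global_F[OF \<alpha>])
  have "0 \<in> D" using stable unfolding asymptotically_stable_def by blast
  then obtain \<rho> where \<rho>: "\<rho> > 0" "ball 0 \<rho> \<subseteq> D" using openD open_contains_ball by blast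
  obtain \<kappa> where \<kappa>: "\<kappa> > 0" "\<And>u v. energy v \<le> energy u \<Longrightarrow> norm v \<le> \<kappa> * norm u"
    using positive_definite_norm_compare[OF pd] unfolding energy_def by blast
  obtain g where g: "g > 0" "\<And>u v. energy v \<le> energy u \<Longrightarrow> norm (gain *v v) \<le> g * norm u"
    by (rule gain_bound) blast
  show ?thesis
    unfolding F.lyapunov_stable_iff
  proof (intro allI impI)
    fix e :: real assume e: "0 < e"
    define \<eta> where "\<eta> = min \<rho> (e / 2)"
    have \<eta>: "\<eta> > 0" "\<eta> \<le> \<rho>" "\<eta> \<le> e / 2" using \<rho> e unfolding \<eta>_def by auto
    obtain d \<delta> where d: "d > 0" "\<delta> > 0" "\<And>x T. perturbed_solution f \<delta> x T \<Longrightarrow> dist (x 0) 0 \<le> d \<Longrightarrow>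
        \<forall>t\<in>{0..T}. dist (x t) 0 < \<eta>"
      using f.total_stability[OF stable \<eta>(1)] by blast
    \<comment> \<open>The bounds serve, in order, the initial estimate in total stability, the
      injected term below \<open>\<delta>\<close>, and the error below \<open>e / 2\<close>.\<close>
    define r where "r = min d (min (\<delta> / (\<alpha> * g)) (e / (2 * \<kappa>)))"
    have r: "r > 0" "r \<le> d" "r \<le> \<delta> / (\<alpha> * g)" "r \<le> e / (2 * \<kappa>)"
      using d \<alpha> g \<kappa> e unfolding r_def by auto
    show "\<exists>d>0. \<forall>x. solution_on (F \<alpha>) x {0..} \<and> dist (x 0) (0, 0) < d \<longrightarrow>
        (\<forall>t\<ge>0. dist (x t) (0, 0) < e)"
    proof (intro exI[of _ r] conjI allI impI r(1))
      fix z t assume z: "solution_on (F \<alpha>) z {0..} \<and> dist (z 0) (0, 0) < r" and t: "(0::real) \<le> t"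
      have z0: "norm (fst (z 0)) < r" "norm (snd (z 0)) < r"
        using z norm_fst_le[of "fst (z 0)" "snd (z 0)"] norm_snd_le[of "snd (z 0)" "fst (z 0)"]
        by (auto simp flip: zero_prod_def)
      have small: "\<alpha> * norm (gain *v v) \<le> \<delta>" if "energy v \<le> energy (snd (z 0))" for v
      proof -
        have "\<alpha> * norm (gain *v v) \<le> \<alpha> * (g * norm (snd (z 0)))"
          using g(2)[OF that] \<alpha> by (intro mult_left_mono) auto
        also have "\<dots> \<le> \<alpha> * (g * r)" using \<alpha> g(1) z0(2) by (intro mult_left_mono) auto
        also have "\<dots> \<le> \<delta>" using r(3) \<alpha> g(1) by (simp add: field_simps)
        finally show ?thesis .
      qed
      have L1: "\<forall>t\<in>{0..T}. fst (z t) \<in> ball 0 \<eta>" if "perturbed_solution f \<delta> (\<lambda>t. fst (z t)) T" for T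
        using d(3)[OF that] z0(1) r(2) by (simp add: dist_commute)
      have L2: "ball 0 \<eta> \<subseteq> D" using \<rho>(2) \<eta>(2) subset_ball by blast
      have "norm (fst (z t)) < e / 2"
        using observer_confined(1)[OF \<alpha> conjunct1[OF z] L1 L2 small t] \<eta>(3) by simp
      moreover have "energy (snd (z t)) \<le> energy (snd (z 0))"
        by (rule observer_confined(2)[OF \<alpha> conjunct1[OF z] L1 L2 small t])
      then have "norm (snd (z t)) \<le> \<kappa> * norm (snd (z 0))" by (rule \<kappa>(2))
      moreover have "\<kappa> * norm (snd (z 0)) < \<kappa> * r" using z0(2) \<kappa>(1) by simp
      moreover have "\<kappa> * r \<le> e / 2" using r(4) \<kappa>(1) by (simp add: field_simps)
      ultimately have "norm (fst (z t)) + norm (snd (z t)) < e" by linarith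
      then show "dist (z t) (0, 0) < e"
        using norm_Pair_le[of "fst (z t)" "snd (z t)"] by (simp flip: zero_prod_def)
    qed
  qed
qed

text \<open>Recurrence brings the trajectory into a Lyapunov neighbourhood of the origin at some
  time \<open>s\<close>; restarting there keeps it within \<open>e\<close> ever after.\<close>

lemma observer_attracted:
  assumes \<alpha>: "\<alpha> > 0" and z: "solution_on (F \<alpha>) z {0..}"
    and L: "compact L" "L \<subseteq> D" "\<And>t. t \<ge> 0 \<Longrightarrow> fst (z t) \<in> L"
  shows "(z \<longlongrightarrow> (0, 0)) at_top"
proof (rule tendstoI)
  interpret F: unique_global_flow "F \<alpha>" by (rule unique_global_F[OF \<alpha>])
  fix e :: real assume "e > 0"
  then obtain d where d: "d > 0" "\<And>x. solution_on (F \<alpha>) x {0..} \<Longrightarrow> dist (x 0) (0, 0) < d \<Longrightarrow>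
      \<forall>t\<ge>0. dist (x t) (0, 0) < e"
    using observer_lyapunov_stable[OF \<alpha>] unfolding F.lyapunov_stable_iff by blast
  obtain s where s: "s \<ge> 0" "norm (z s) < d"
    using observer_recurrent[OF \<alpha> z L d(1)] by blast
  have "dist (z (s + 0)) (0, 0) < d" using s(2) by (simp flip: zero_prod_def)
  then have "\<forall>t\<ge>0. dist (z (s + t)) (0, 0) < e"
    using d(2)[OF solution_on_shift[OF z s(1)]] by blast
  then have "dist (z t) (0, 0) < e" if "t \<ge> s" for t
    using that by (auto dest!: spec[of _ "t - s"])
  then show "\<forall>\<^sub>F t in at_top. dist (z t) (0, 0) < e"
    by (rule eventually_at_top_linorderI)
qed

text \<open>Lyapunov stability at level \<open>\<rho>\<close> already confines the estimate to a
  compact ball inside \<open>D\<close>, so attraction applies on a whole neighbourhood.\<close>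

lemma observer_asymptotically_stable:
  assumes \<alpha>: "\<alpha> > 0"
  shows "asymptotically_stable (F \<alpha>) (0, 0)"
proof -
  interpret F: unique_global_flow "F \<alpha>" by (rule unique_global_F[OF \<alpha>])
  have "0 \<in> D" "f 0 = 0" using stable unfolding asymptotically_stable_def by blast+
  then obtain \<rho> where \<rho>: "\<rho> > 0" "cball 0 \<rho> \<subseteq> D" using openD open_contains_cball by blast
  obtain d where d: "d > 0" "\<And>x. solution_on (F \<alpha>) x {0..} \<Longrightarrow> dist (x 0) (0, 0) < d \<Longrightarrow>
      \<forall>t\<ge>0. dist (x t) (0, 0) < \<rho>"
    using observer_lyapunov_stable[OF \<alpha>] \<rho>(1) unfolding F.lyapunov_stable_iff by blast
  have "ball (0, 0) d \<subseteq> basin_of_attraction (F \<alpha>) (0, 0)"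
    unfolding F.basin_of_attraction_eq
  proof (intro subsetI CollectI allI impI)
    fix z0 z assume z0: "z0 \<in> ball (0, 0) d" and z: "solution_on (F \<alpha>) z {0..} \<and> z 0 = z0"
    have "fst (z t) \<in> cball 0 \<rho>" if "t \<ge> 0" for t
    proof -
      have "norm (z t) < \<rho>"
        using d(2)[of z] z z0 that by (auto simp: dist_commute simp flip: zero_prod_def)
      then show ?thesis using norm_fst_le[of "fst (z t)" "snd (z t)"] by simp
    qed
    then show "(z \<longlongrightarrow> (0, 0)) at_top"
      using observer_attracted[OF \<alpha> conjunct1[OF z] compact_cball \<rho>(2)] by blast
  qed
  moreover have "F \<alpha> (0, 0) = (0, 0)" using \<open>f 0 = 0\<close> by (simp add: F_eq)
  ultimately show ?thesis
    unfolding asymptotically_stable_def using observer_lyapunov_stable[OF \<alpha>] d(1)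
    by (metis centre_in_ball open_ball zero_prod_def)
qed

text \<open>Large initial errors are compensated by small \<open>\<alpha>\<close>: confinement of
  estimates starting in \<open>K1\<close> tolerates a defect \<open>\<delta>\<close> that depends on
  \<open>K1\<close> but not on \<open>\<alpha>\<close>.\<close>

lemma observer_basin:
  assumes K: "compact K1" "compact K2" "K1 \<subseteq> D"
  shows "\<exists>\<alpha>0>0. \<forall>\<alpha>. 0 < \<alpha> \<and> \<alpha> < \<alpha>0 \<longrightarrow> K1 \<times> K2 \<subseteq> basin_of_attraction (F \<alpha>) (0, 0)"
proof -
  obtain \<delta> L where \<delta>: "\<delta> > 0" "compact L" "L \<subseteq> D"
    "\<And>x T. perturbed_solution f \<delta> x T \<Longrightarrow> x 0 \<in> K1 \<Longrightarrow> \<forall>t\<in>{0..T}. x t \<in> L"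
    using f.perturbed_confined[OF stable openD K(1,3)] by blast
  obtain g where g: "g > 0" "\<And>u v. energy v \<le> energy u \<Longrightarrow> norm (gain *v v) \<le> g * norm u"
    by (rule gain_bound) blast
  obtain R where R: "R > 0" "\<And>u. u \<in> K2 \<Longrightarrow> norm u \<le> R"
    using compact_imp_bounded[OF K(2)] bounded_pos by blast
  show ?thesis
  proof (intro exI conjI allI impI)
    \<comment> \<open>\<open>R\<close> bounds the errors in \<open>K2\<close>, so below this
      threshold the injected term is at most \<open>\<delta>\<close> as long as the energy is at
      most its initial value.\<close>
    show "\<delta> / (g * R) > 0" using \<delta> g R by simp
    fix \<alpha> assume "0 < \<alpha> \<and> \<alpha> < \<delta> / (g * R)"
    then have \<alpha>: "0 < \<alpha>" "\<alpha> * (g * R) \<le> \<delta>" using g R by (auto simp: field_simps)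
    interpret F: unique_global_flow "F \<alpha>" by (rule unique_global_F[OF \<alpha>(1)])
    show "K1 \<times> K2 \<subseteq> basin_of_attraction (F \<alpha>) (0, 0)"
      unfolding F.basin_of_attraction_eq
    proof (intro subsetI CollectI allI impI)
      fix z0 z assume z0: "z0 \<in> K1 \<times> K2" and z: "solution_on (F \<alpha>) z {0..} \<and> z 0 = z0"
      have small: "\<alpha> * norm (gain *v v) \<le> \<delta>" if "energy v \<le> energy (snd (z 0))" for v
      proof -
        have "norm (gain *v v) \<le> g * norm (snd (z 0))" by (rule g(2)[OF that])
        also have "\<dots> \<le> g * R" using g(1) R(2)[of "snd (z 0)"] z z0 by (intro mult_left_mono) auto
        finally show ?thesis using \<alpha> by (meson mult_left_mono less_imp_le order_trans)
      qed
      have L1: "\<forall>t\<in>{0..T}. fst (z t) \<in> L" if "perturbed_solution f \<delta> (\<lambda>t. fst (z t)) T" for T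
        by (rule \<delta>(4)[OF that]) (use z z0 in auto)
      have "fst (z t) \<in> L" if "t \<ge> 0" for t
        by (rule observer_confined(1)[OF \<alpha>(1) conjunct1[OF z] L1 \<delta>(3) small that])
      then show "(z \<longlongrightarrow> (0, 0)) at_top"
        using observer_attracted[OF \<alpha>(1) conjunct1[OF z] \<delta>(2,3)] by blast
    qed
  qed
qed

end

section \<open>Semi-global asymptotic stability of the coupled system\<close>

theorem theorem4:
  fixes A :: "real^'m \<Rightarrow> real^'n^'n"
    and B :: "real^'m \<Rightarrow> real^'n"
    and C :: "real^'n^'p"
    and l :: "real^'n \<Rightarrow> real^'m"
    and P :: "real^'n^'n"
    and D :: "(real^'n) set"
  assumes "continuous_on UNIV A"
    and "continuous_on UNIV B"
    and "continuous_on UNIV l"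
    and "l 0 = 0"
    and well_posed: "\<And>\<alpha> Q xh0 e0. \<alpha> > 0 \<Longrightarrow> positive_definite Q \<Longrightarrow>
          unique_global_solution (observer_system A B C l \<alpha> Q) (xh0, e0)"
    and "open D" and "D \<noteq> {}"
    and stabilizability: "asymptotically_stable (feedback_field A B l) 0"
          "basin_of_attraction (feedback_field A B l) 0 = D"
    and "positive_definite P"
    and dissipativity: "\<And>x xh. xh \<in> D \<Longrightarrow> x \<bullet> ((P ** A (l xh)) *v x) \<le> 0"
    and detectability: "detectable C (A 0)"
  shows "\<forall>K1 K2. compact (K1 \<times> K2) \<and> K1 \<times> K2 \<subseteq> D \<times> (UNIV :: (real^'n) set) \<longrightarrow>
           (\<exists>\<alpha>0>0. \<forall>\<alpha>. 0 < \<alpha> \<and> \<alpha> < \<alpha>0 \<longrightarrow>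
              asymptotically_stable (observer_system A B C l \<alpha> P) (0, 0) \<and>
              K1 \<times> K2 \<subseteq> basin_of_attraction (observer_system A B C l \<alpha> P) (0, 0))"
proof (intro allI impI)
  fix K1 K2 :: "(real^'n) set"
  assume K: "compact (K1 \<times> K2) \<and> K1 \<times> K2 \<subseteq> D \<times> (UNIV :: (real^'n) set)"
  interpret observer_problem A B C l P
    by unfold_locales (use assms in auto)
  \<comment> \<open>Asymptotic stability holds for every positive \<open>\<alpha>\<close>; only the
    inclusion in the basin restricts \<open>\<alpha>0\<close>.\<close>
  have "\<exists>\<alpha>0>0. \<forall>\<alpha>. 0 < \<alpha> \<and> \<alpha> < \<alpha>0 \<longrightarrow>
      K1 \<times> K2 \<subseteq> basin_of_attraction (observer_system A B C l \<alpha> P) (0, 0)"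
  \<comment> \<open>An empty product says nothing about its other factor; a nonempty one projects
    onto both, which gives compactness of each.\<close>
  proof (cases "K1 \<times> K2 = {}")
    case False
    then have "fst ` (K1 \<times> K2) = K1" "snd ` (K1 \<times> K2) = K2" by auto
    then have "compact K1" "compact K2"
      using K compact_continuous_image[OF continuous_on_fst[OF continuous_on_id]]
        compact_continuous_image[OF continuous_on_snd[OF continuous_on_id]] by metis+
    moreover have "K1 \<subseteq> basin_of_attraction (feedback_field A B l) 0"
      using K False stabilizability(2) by auto
    ultimately show ?thesis by (rule observer_basin)
  next
    case True
    then show ?thesis using zero_less_one by blast
  qed
  then show "\<exists>\<alpha>0>0. \<forall>\<alpha>. 0 < \<alpha> \<and> \<alpha> < \<alpha>0 \<longrightarrow>
      asymptotically_stable (observer_system A B C l \<alpha> P) (0, 0) \<and>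
      K1 \<times> K2 \<subseteq> basin_of_attraction (observer_system A B C l \<alpha> P) (0, 0)"
    using observer_asymptotically_stable by blast
qed

end
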